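(* Let $d\ge2$ be an integer, and let $\sigma$ be a (finite, positive) measure on $\mathbb{T}^d$ such that $|\widehat\sigma(\xi)|\lesssim(1+|\xi|)^{-\frac{d-1}{2}}$ for all $\xi\in\mathbb{Z}^d$. For $N\ge2$ and complex coefficients $a=(a_{\mathbf n})_{\mathbf n\in\{1,\dots,N\}^{d-1}}$ let $$S^{\mathbb{P}}_{a,d}(x,N)=\sum_{\mathbf n=(n_1,\dots,n_{d-1})\in\{1,\dots,N\}^{d-1}}a_{\mathbf n}\,e\big(n_1x_1+\dots+n_{d-1}x_{d-1}+(n_1^2+\dots+n_{d-1}^2)x_d\big),\quad x\in\mathbb{T}^d.$$ Then $$\int_{\mathbb{T}^d}|S^{\mathbb{P}}_{a,d}(x,N)|^2\,d\sigma(x)\lesssim\|a\|_{\ell^2(\{1,\dots,N\}^{d-1})}^2\,B_d(N),\qquad B_d(N)=N^{\frac{d-3}{2}}\begin{cases}N^{1/2},&d=2\\ \log N,&d=3\\ 1,&d\ge4,\end{cases}$$ with the implicit constant independent of $N$ (and of $a$). Moreover, for each $d\ge 2$ this estimate is sharp in terms of the dependence on $N$: the factor $B_d(N)$ cannot be replaced, in an estimate valid for all such measures $\sigma$ and all $a$, by a quantity $b(N)$ with $b(N)/B_d(N)\to 0$ as $N\to\infty$.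
   Context: $e(t)=e^{2\pi it}$; $\widehat\sigma(\xi)=\int_{\mathbb{T}^d}e(-\xi\cdot x)\,d\sigma(x)$. The implicit constant may depend on $d$ and $\sigma$. *)

theory Defs
  imports "HOL-Analysis.Analysis"
begin

definition e :: "real \<Rightarrow> complex" where
  "e t = exp (2 * of_real pi * \<i> * of_real t)"

text \<open>
  The torus is represented by its fundamental domain \<open>[0,1)\<^sup>d\<close>, with coordinates indexed by
  \<open>1, ..., d\<close>. Only its measurable structure is used: the projection from \<open>[0,1)\<^sup>d\<close> to the
  quotient of \<open>\<real>\<^sup>d\<close> by the integer lattice is a Borel isomorphism. Of the product measure
  below only the underlying measurable space matters.
\<close>
definition torus :: "nat \<Rightarrow> (nat \<Rightarrow> real) measure" where
  "torus d = (\<Pi>\<^sub>M i\<in>{1..d}. restrict_space borel {0..<1})"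

definition torus_measure :: "nat \<Rightarrow> (nat \<Rightarrow> real) measure \<Rightarrow> bool" where
  "torus_measure d \<sigma> \<longleftrightarrow> finite_measure \<sigma> \<and> sets \<sigma> = sets (torus d)"

definition fourier_coeff :: "nat \<Rightarrow> (nat \<Rightarrow> real) measure \<Rightarrow> (nat \<Rightarrow> int) \<Rightarrow> complex" where
  "fourier_coeff d \<sigma> \<xi> = (LINT x|\<sigma>. e (- (\<Sum>i=1..d. of_int (\<xi> i) * x i)))"

definition fourier_decay :: "nat \<Rightarrow> (nat \<Rightarrow> real) measure \<Rightarrow> bool" where
  "fourier_decay d \<sigma> \<longleftrightarrow>
     (\<exists>C::real. \<forall>\<xi> \<in> {1..d} \<rightarrow>\<^sub>E UNIV.
        cmod (fourier_coeff d \<sigma> \<xi>)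
          \<le> C * (1 + L2_set (\<lambda>i. of_int (\<xi> i)) {1..d}) powr (- ((real d - 1) / 2)))"

definition frequencies :: "nat \<Rightarrow> nat \<Rightarrow> (nat \<Rightarrow> nat) set" where
  "frequencies d N = {1..d-1} \<rightarrow>\<^sub>E {1..N}"

definition parabolic_sum ::
    "((nat \<Rightarrow> nat) \<Rightarrow> complex) \<Rightarrow> nat \<Rightarrow> (nat \<Rightarrow> real) \<Rightarrow> nat \<Rightarrow> complex" where
  "parabolic_sum a d x N =
     (\<Sum>n\<in>frequencies d N.
        a n * e ((\<Sum>i=1..d-1. real (n i) * x i) + (\<Sum>i=1..d-1. (real (n i))\<^sup>2) * x d))"

definition B :: "nat \<Rightarrow> nat \<Rightarrow> real" where
  "B d N = real N powr ((real d - 3) / 2) *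
     (if d = 2 then real N powr (1/2) else if d = 3 then ln (real N) else 1)"

text \<open>The constant may depend on \<open>d\<close> and \<open>\<sigma>\<close>, but not on \<open>N\<close> or \<open>a\<close>.\<close>
definition L2_estimate :: "nat \<Rightarrow> (nat \<Rightarrow> real) measure \<Rightarrow> (nat \<Rightarrow> real) \<Rightarrow> bool" where
  "L2_estimate d \<sigma> b \<longleftrightarrow>
     (\<exists>C::real. \<forall>N\<ge>2. \<forall>a.
        (LINT x|\<sigma>. (cmod (parabolic_sum a d x N))\<^sup>2)
          \<le> C * (L2_set (\<lambda>n. cmod (a n)) (frequencies d N))\<^sup>2 * b N)"

end

(* Expanding the square turns the integral into a bilinear form in a whose kernel is the Fourier
   transform of sigma at (m - n, |m|^2 - |n|^2).

   Upper bound: Schur's test.  For d >= 3, split the row sum according to the largest coordinate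
   m_j of m.  If | |m|^2 - |n|^2 | is at least m_j^2 / 2, the terms are of size m_j^(-(d-1)), which
   sums to O(log N).  Otherwise m_j is comparable to |n|; with the other coordinates fixed,
   |m|^2 - |n|^2 runs through values whose consecutive gaps are of order at least |n| as m_j varies,
   so the sum over m_j is essentially its largest term plus a tail.  For d = 2 the row sums lose a
   logarithm, which the weight m^(-1/2) removes.

   Sharpness: superpose Fejer kernels of all dyadic scales 2^j with weights 2^(-j(d-1)/2).  The
   Fourier transform is nonnegative, so for a = 1 the integral is bounded from below by counting the
   pairs (n, m) with | |n|^2 - |m|^2 | <= 2^j, for N <= 2^j <= N^2, with the pigeonhole principle. *)
theory Submission imports Defs begin

subsection \<open>Elementary sums\<close>

text \<open>Write k = d - 1, so the decay exponent is k/2. For d \<ge> 3 the terms with widely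
  different squared norms cost only a logarithm: about t^(k-1) points have largest coordinate t, and
  each contributes t^(-k). In the remaining range there are about |n|^(k-1) lines on which only m_j
  varies. Their tails, with spacing |n|, add up to |n|^(k-1-k/2) = |n|^(k/2-1), the order of
  \<open>B d\<close>, up to a logarithm when k = 2. The obstacle is the largest term of each line:
  the bound 1 for it would give |n|^(k-1) in total. There the decay in m - n must be used instead.
  Taking the geometric mean of its bounds in the other k - 1 coordinates makes the sum factor into
  one-dimensional sums of exponent k/(2(k-1)), and their product is again |n|^(k/2-1), with a
  logarithm exactly for k = 2, where that exponent is 1.\<close>

text \<open>The mean value theorem on a unit step; it makes the two power sums below telescope and
  so stands in for a comparison with integrals.\<close>

lemma powr_diff_eq:
  fixes x c :: real
  assumes "0 < x"
  obtains z where "x < z" "z < x + 1" "(x + 1) powr c - x powr c = c * z powr (c - 1)"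
proof -
  have "\<exists>z. x < z \<and> z < x + 1 \<and> (x + 1) powr c - x powr c = (x + 1 - x) * (c * z powr (c - 1))"
    by (rule MVT2) (use assms in \<open>auto intro!: derivative_eq_intros\<close>)
  then show ?thesis using that by auto
qed

lemma sum_powr_neg_le:
  fixes \<theta> :: real
  assumes "0 \<le> \<theta>" "\<theta> < 1"
  shows "(\<Sum>v=1..R. real v powr (-\<theta>)) \<le> real R powr (1 - \<theta>) / (1 - \<theta>)"
proof (induction R)
  case 0
  then show ?case by simp
next
  case (Suc n)
  \<comment> \<open>Each term is at most an increment of x^(1-\<theta>) / (1-\<theta>). The first
    increment is treated apart, because the mean value step needs a positive left endpoint.\<close>
  have "real (Suc n) powr (-\<theta>) \<le> (real (Suc n) powr (1 - \<theta>) - real n powr (1 - \<theta>)) / (1 - \<theta>)"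
  proof (cases "n = 0")
    case True
    then show ?thesis using assms by simp
  next
    case False
    then obtain z where z: "real n < z" "z < real n + 1"
      "(real n + 1) powr (1 - \<theta>) - real n powr (1 - \<theta>) = (1 - \<theta>) * z powr (1 - \<theta> - 1)"
      using powr_diff_eq[of "real n" "1 - \<theta>"] by auto
    have "(real n + 1) powr (-\<theta>) \<le> z powr (-\<theta>)"
      using z assms by (intro powr_mono2') auto
    then show ?thesis using z assms by (simp add: add.commute)
  qed
  with Suc show ?case by (simp add: diff_divide_distrib)
qed

lemma sum_powr_minus_three_halves_le:
  fixes n :: nat
  assumes "n \<ge> 1"
  shows "(\<Sum>t\<in>{n<..M}. real t powr (-3/2)) \<le> 2 * real n powr (-1/2)"
proof -
  \<comment> \<open>The subtracted term in M is what makes the bound inductive; it is dropped at the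
    end.\<close>
  have "(\<Sum>t\<in>{n<..M}. real t powr (-3/2)) \<le> 2 * (real n powr (-1/2) - real M powr (-1/2))"
    if "n \<le> M"
    using that
  proof (induction M rule: dec_induct)
    case base
    then show ?case by simp
  next
    case (step M)
    obtain z where z: "real M < z" "z < real M + 1"
      "(real M + 1) powr (-1/2) - real M powr (-1/2) = (-1/2) * z powr (-1/2 - 1)"
      using powr_diff_eq[of "real M" "-1/2"] step assms by auto
    have "(real M + 1) powr (-3/2) \<le> z powr (-3/2)"
      using z by (intro powr_mono2') auto
    moreover have "{n<..Suc M} = insert (Suc M) {n<..M}" using step by auto
    ultimately show ?case using step z by (simp add: add.commute)
  qed
  moreover have "(\<Sum>t\<in>{n<..M}. real t powr (-3/2)) = 0" if "\<not> n \<le> M"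
    using that by simp
  ultimately show ?thesis by (cases "n \<le> M") (fastforce intro: order_trans)+
qed

lemma sum_inverse_le_ln: "n \<ge> 1 \<Longrightarrow> (\<Sum>v=1..n. 1 / real v) \<le> 1 + ln (real n)"
proof (induction n rule: dec_induct)
  case base
  then show ?case by simp
next
  case (step n)
  have "ln (real n / real (Suc n)) \<le> real n / real (Suc n) - 1"
    using step by (intro ln_le_minus_one) auto
  moreover have "real n / real (Suc n) - 1 = - (1 / real (Suc n))"
    by (simp add: field_simps)
  ultimately show ?case using step by (simp add: ln_div)
qed

lemma sum_inj_on_le:
  fixes g :: "nat \<Rightarrow> real" and h :: "nat \<Rightarrow> nat"
  assumes "inj_on h A" "h ` A \<subseteq> C" "finite C" "\<And>x. x \<in> C \<Longrightarrow> 0 \<le> g x"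
  shows "(\<Sum>t\<in>A. g (h t)) \<le> sum g C"
proof -
  have "(\<Sum>t\<in>A. g (h t)) = sum g (h ` A)"
    using assms by (simp add: sum.reindex)
  also have "\<dots> \<le> sum g C"
    using assms by (intro sum_mono2) auto
  finally show ?thesis .
qed

text \<open>Consecutive elements of \<open>S\<close> have squares at distance at least \<open>l\<close>, so apart from the
  element nearest to a zero of \<open>t\<^sup>2 + T\<close> on either side, the values of \<open>t\<^sup>2 + T\<close> are as spread out
  as the multiples of \<open>l\<close>.\<close>
lemma sum_near_square_le:
  fixes K :: "nat \<Rightarrow> real" and T P l \<beta> :: real
  assumes S: "S \<subseteq> {1..N}" "\<And>t. t \<in> S \<Longrightarrow> l \<le> real t" and "0 < l" "0 \<le> \<beta>" "0 \<le> P"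
    and K: "\<And>t. t \<in> S \<Longrightarrow> K t \<le> P" 
           "\<And>t. t \<in> S \<Longrightarrow> K t \<le> (1 + \<bar>(real t)\<^sup>2 + T\<bar>) powr (-\<beta>)"
  shows "(\<Sum>t\<in>S. K t) \<le> 2 * (P + (\<Sum>q=1..N. (l * real q) powr (-\<beta>)))"
proof -
  let ?g = "\<lambda>q. (l * real q) powr (-\<beta>)"
  have finS: "finite S" using S finite_subset by blast
  \<comment> \<open>One side of the zero of t^2 + T. The point \<open>t0\<close> of \<open>A\<close>
    nearest to it is charged to \<open>P\<close>; for every other point, t^2 is at least as far from
    the zero as from \<open>t0\<close>^2.\<close>
  have half: "sum K A \<le> P + (\<Sum>q=1..N. ?g q)"
    if A: "A \<subseteq> S" and t0: "t0 \<in> A"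
      and far: "\<And>t. t \<in> A \<Longrightarrow> \<bar>(real t)\<^sup>2 - (real t0)\<^sup>2\<bar> \<le> \<bar>(real t)\<^sup>2 + T\<bar>"
      and inj: "inj_on (\<lambda>t. nat \<bar>int t - int t0\<bar>) A" for A t0
  proof -
    let ?h = "\<lambda>t. nat \<bar>int t - int t0\<bar>"
    have *: "K t \<le> ?g (?h t)" if t: "t \<in> A - {t0}" for t
    proof -
      \<comment> \<open>The gap of the squares factors as (t + t0) |t - t0|, and the first factor is
        at least \<open>l\<close>. So the q-th neighbour of \<open>t0\<close> is at squared distance
        at least \<open>l\<close> q.\<close>
      have "l * real (?h t) \<le> (real t + real t0) * \<bar>real t - real t0\<bar>"
      proof -
        have "real (?h t) = \<bar>real t - real t0\<bar>" by simp
        moreover have "l \<le> real t + real t0" using t A t0 S(2) by (smt (verit) Diff_iff of_nat_0_le_iff subsetD)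
        ultimately show ?thesis by (metis abs_ge_zero mult_right_mono)
      qed
      also have "\<dots> = \<bar>(real t)\<^sup>2 - (real t0)\<^sup>2\<bar>"
        by (simp add: abs_mult power2_eq_square square_diff_square_factored)
      also have "\<dots> \<le> 1 + \<bar>(real t)\<^sup>2 + T\<bar>" using far[of t] t by auto
      finally have "(1 + \<bar>(real t)\<^sup>2 + T\<bar>) powr (-\<beta>) \<le> ?g (?h t)"
        using \<open>0 < l\<close> \<open>0 \<le> \<beta>\<close> t by (intro powr_mono2') auto
      then show ?thesis using K(2)[of t] t A by (meson DiffD1 order_trans subsetD)
    qed
    have "sum K (A - {t0}) \<le> (\<Sum>t\<in>A - {t0}. ?g (?h t))"
      by (intro sum_mono *)
    also have "\<dots> \<le> (\<Sum>q=1..N. ?g q)"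
    proof (rule sum_inj_on_le)
      show "inj_on ?h (A - {t0})" using inj by (rule inj_on_diff)
      show "?h ` (A - {t0}) \<subseteq> {1..N}"
      proof
        fix q assume "q \<in> ?h ` (A - {t0})"
        then obtain t where t: "t \<in> A" "t \<noteq> t0" "q = ?h t" by auto
        then have "t \<in> {1..N}" "t0 \<in> {1..N}" using A t0 S(1) by auto
        then show "q \<in> {1..N}" using t by auto
      qed
    qed auto
    finally have "sum K (A - {t0}) \<le> (\<Sum>q=1..N. ?g q)" .
    moreover have "sum K A = K t0 + sum K (A - {t0})"
      using t0 A finS by (intro sum.remove) (auto intro: finite_subset)
    ultimately show ?thesis using K(1)[of t0] t0 A by auto
  qed
  \<comment> \<open>Since t^2 + T increases with t, the point nearest to the zero is the minimum of
    \<open>?A1\<close> and the maximum of \<open>?A2\<close>. All points of a part lie on one side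
    of it, so the distance to it determines the point. The two parts give the factor 2.\<close>
  let ?A1 = "{t \<in> S. 0 \<le> (real t)\<^sup>2 + T}" and ?A2 = "{t \<in> S. (real t)\<^sup>2 + T < 0}"
  have nonneg: "0 \<le> P + (\<Sum>q=1..N. ?g q)" using \<open>0 \<le> P\<close> by (intro add_nonneg_nonneg sum_nonneg) auto
  have "sum K ?A1 \<le> P + (\<Sum>q=1..N. ?g q)"
  proof (cases "?A1 = {}")
    case False
    define t0 where "t0 = Min ?A1"
    have t0: "t0 \<in> ?A1" unfolding t0_def using False finS by (intro Min_in) auto
    have le: "t0 \<le> t" if "t \<in> ?A1" for t unfolding t0_def using that finS by (intro Min_le) auto
    show ?thesis
    proof (rule half[of _ t0])
      fix t assume t: "t \<in> ?A1"
      then have "(real t0)\<^sup>2 \<le> (real t)\<^sup>2" using le by (intro power_mono) auto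
      then show "\<bar>(real t)\<^sup>2 - (real t0)\<^sup>2\<bar> \<le> \<bar>(real t)\<^sup>2 + T\<bar>" using t t0 by auto
    next
      show "inj_on (\<lambda>t. nat \<bar>int t - int t0\<bar>) ?A1"
      proof (rule inj_onI)
        fix x y assume xy: "x \<in> ?A1" "y \<in> ?A1" "nat \<bar>int x - int t0\<bar> = nat \<bar>int y - int t0\<bar>"
        show "x = y" using le[OF xy(1)] le[OF xy(2)] xy(3) by linarith
      qed
    qed (use t0 in auto)
  qed (use nonneg in \<open>simp del: Collect_empty_eq\<close>)
  moreover have "sum K ?A2 \<le> P + (\<Sum>q=1..N. ?g q)"
  proof (cases "?A2 = {}")
    case False
    define t0 where "t0 = Max ?A2"
    have t0: "t0 \<in> ?A2" unfolding t0_def using False finS by (intro Max_in) auto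
    have le: "t \<le> t0" if "t \<in> ?A2" for t unfolding t0_def using that finS by (intro Max_ge) auto
    show ?thesis
    proof (rule half[of _ t0])
      fix t assume t: "t \<in> ?A2"
      then have "(real t)\<^sup>2 \<le> (real t0)\<^sup>2" using le by (intro power_mono) auto
      then show "\<bar>(real t)\<^sup>2 - (real t0)\<^sup>2\<bar> \<le> \<bar>(real t)\<^sup>2 + T\<bar>" using t t0 by auto
    next
      show "inj_on (\<lambda>t. nat \<bar>int t - int t0\<bar>) ?A2"
      proof (rule inj_onI)
        fix x y assume xy: "x \<in> ?A2" "y \<in> ?A2" "nat \<bar>int x - int t0\<bar> = nat \<bar>int y - int t0\<bar>"
        show "x = y" using le[OF xy(1)] le[OF xy(2)] xy(3) by linarith
      qed
    qed (use t0 in auto)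
  qed (use nonneg in \<open>simp del: Collect_empty_eq\<close>)
  moreover have "sum K S = sum K ?A1 + sum K ?A2"
  proof -
    have "S = ?A1 \<union> ?A2" by auto
    moreover have "sum K (?A1 \<union> ?A2) = sum K ?A1 + sum K ?A2"
      using finS by (intro sum.union_disjoint) auto
    ultimately show ?thesis by simp
  qed
  ultimately show ?thesis by simp
qed

text \<open>The weight \<open>w\<close> is only needed for \<open>d = 2\<close>, where the unweighted row sums grow like \<open>ln N\<close>.\<close>
lemma weighted_schur_test:
  fixes K :: "'a \<Rightarrow> 'a \<Rightarrow> real" and w u :: "'a \<Rightarrow> real"
  assumes "finite F" and sym: "\<And>n m. n \<in> F \<Longrightarrow> m \<in> F \<Longrightarrow> K n m = K m n"
    and nonneg: "\<And>n m. n \<in> F \<Longrightarrow> m \<in> F \<Longrightarrow> 0 \<le> K n m"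
    and w: "\<And>n. n \<in> F \<Longrightarrow> 0 < w n"
    and row: "\<And>n. n \<in> F \<Longrightarrow> (\<Sum>m\<in>F. K n m * w m) \<le> A * w n"
  shows "(\<Sum>n\<in>F. \<Sum>m\<in>F. K n m * (u n * u m)) \<le> A * (\<Sum>n\<in>F. (u n)\<^sup>2)"
proof -
  let ?f = "\<lambda>n m. K n m * ((u n)\<^sup>2 * (w m / w n)) / 2"
  \<comment> \<open>Weighted arithmetic-geometric inequality. The two halves are transposes of each
    other, so after exchanging the sums both lead to the same weighted row sum.\<close>
  have "K n m * (u n * u m) \<le> ?f n m + ?f m n" if "n \<in> F" "m \<in> F" for n m
  proof -
    have pos: "0 < w n" "0 < w m" using w that by auto
    define X Y where "X = (u n)\<^sup>2 * (w m / w n)" and "Y = (u m)\<^sup>2 * (w n / w m)"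
    have "0 \<le> (u n * w m - u m * w n)\<^sup>2 / (w n * w m)" using pos by simp
    also have "\<dots> = X + Y - 2 * (u n * u m)"
      using pos by (simp add: X_def Y_def power2_eq_square field_simps)
    finally have "K n m * (2 * (u n * u m)) \<le> K n m * (X + Y)"
      using nonneg[OF that] by (intro mult_left_mono) auto
    then have "2 * (K n m * (u n * u m)) \<le> K n m * X + K n m * Y" by (simp add: distrib_left)
    then show ?thesis using sym[OF that] unfolding X_def[symmetric] Y_def[symmetric] by simp
  qed
  then have "(\<Sum>n\<in>F. \<Sum>m\<in>F. K n m * (u n * u m)) \<le> (\<Sum>n\<in>F. \<Sum>m\<in>F. ?f n m + ?f m n)"
    by (intro sum_mono) auto
  also have "\<dots> = (\<Sum>n\<in>F. \<Sum>m\<in>F. ?f n m) + (\<Sum>n\<in>F. \<Sum>m\<in>F. ?f m n)"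
    by (simp add: sum.distrib)
  also have "(\<Sum>n\<in>F. \<Sum>m\<in>F. ?f m n) = (\<Sum>n\<in>F. \<Sum>m\<in>F. ?f n m)" by (rule sum.swap)
  also have "(\<Sum>n\<in>F. \<Sum>m\<in>F. ?f n m) + (\<Sum>n\<in>F. \<Sum>m\<in>F. ?f n m)
      = (\<Sum>n\<in>F. (u n)\<^sup>2 / w n * (\<Sum>m\<in>F. K n m * w m))"
    by (simp flip: sum.distrib add: sum_distrib_left sum_divide_distrib mult_ac)
  also have "\<dots> \<le> (\<Sum>n\<in>F. (u n)\<^sup>2 / w n * (A * w n))"
    using row w by (intro sum_mono mult_left_mono) (auto simp: less_imp_le)
  also have "\<dots> = (\<Sum>n\<in>F. A * (u n)\<^sup>2)" by (intro sum.cong) (use w in \<open>force simp: field_simps\<close>)+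
  finally show ?thesis by (simp add: sum_distrib_left)
qed

subsection \<open>Row sums of the decay kernel\<close>

text \<open>Iterated summation over a box with coordinate \<open>j\<close> innermost, so that the
  coordinate along which the squares are spread out can be summed first.\<close>

lemma sum_PiE_insert:
  assumes "finite J" "j \<notin> J"
  shows "(\<Sum>f\<in>PiE (insert j J) T. h f) = (\<Sum>g\<in>PiE J T. \<Sum>t\<in>T j. h (g(j := t)))"
proof -
  have "(\<Sum>f\<in>PiE (insert j J) T. h f) = (\<Sum>(t, g)\<in>T j \<times> PiE J T. h (g(j := t)))"
    unfolding PiE_insert_eq
    by (subst sum.reindex[OF inj_combinator[OF assms(2)]]) (simp add: case_prod_unfold)
  also have "\<dots> = (\<Sum>t\<in>T j. \<Sum>g\<in>PiE J T. h (g(j := t)))"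
    by (rule sum.cartesian_product[symmetric])
  finally show ?thesis by (simp only: sum.swap[of _ "T j"])
qed

text \<open>On either side of \<open>n\<close> each value of 1 + |n - u| occurs at most once, and it
  lies in 1..R because \<open>n\<close> does.\<close>

lemma sum_dist_powr_le:
  fixes \<theta> :: real
  assumes "n \<in> {1..R}"
  shows "(\<Sum>u=1..R. (1 + \<bar>real n - real u\<bar>) powr (-\<theta>)) \<le> 2 * (\<Sum>v=1..R. real v powr (-\<theta>))"
proof -
  let ?h = "\<lambda>u. 1 + nat \<bar>int n - int u\<bar>"
  have eq: "(1 + \<bar>real n - real u\<bar>) powr (-\<theta>) = real (?h u) powr (-\<theta>)" for u
  proof -
    have "1 + \<bar>real n - real u\<bar> = real (?h u)" by simp
    then show ?thesis by simp
  qed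
  have part: "(\<Sum>u\<in>A. real (?h u) powr (-\<theta>)) \<le> (\<Sum>v=1..R. real v powr (-\<theta>))"
    if "A \<subseteq> {1..R}" "inj_on ?h A" for A
  proof (rule sum_inj_on_le[where g = "\<lambda>v. real v powr (-\<theta>)"])
    show "?h ` A \<subseteq> {1..R}"
    proof
      fix v assume "v \<in> ?h ` A"
      then obtain u where u: "u \<in> A" "v = ?h u" by blast
      then have "u \<in> {1..R}" using that(1) by blast
      then show "v \<in> {1..R}" using assms u(2) by auto
    qed
  qed (use that in auto)
  have "{1..R} = {1..n} \<union> {n<..R}" using assms by auto
  then have "(\<Sum>u=1..R. real (?h u) powr (-\<theta>))
      = (\<Sum>u\<in>{1..n}. real (?h u) powr (-\<theta>)) + (\<Sum>u\<in>{n<..R}. real (?h u) powr (-\<theta>))"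
    by (simp only:) (intro sum.union_disjoint, auto)
  moreover have "(\<Sum>u\<in>{1..n}. real (?h u) powr (-\<theta>)) \<le> (\<Sum>v=1..R. real v powr (-\<theta>))"
    using assms by (intro part) (auto simp: inj_on_def)
  moreover have "(\<Sum>u\<in>{n<..R}. real (?h u) powr (-\<theta>)) \<le> (\<Sum>v=1..R. real v powr (-\<theta>))"
    using assms by (intro part) (auto simp: inj_on_def)
  ultimately show ?thesis by (simp only: eq)
qed

lemma card_PiE_dominated_coordinate_le:
  fixes k :: nat
  assumes "j \<in> {1..k}"
  shows "card {m \<in> {1..k} \<rightarrow>\<^sub>E {1..N}. (\<forall>i\<in>{1..k}. m i \<le> m j) \<and> m j = t} \<le> t ^ (k - 1)"
proof -
  let ?T = "\<lambda>i. if i = j then {t} else {1..t}"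
  have "card {m \<in> {1..k} \<rightarrow>\<^sub>E {1..N}. (\<forall>i\<in>{1..k}. m i \<le> m j) \<and> m j = t} \<le> card (PiE {1..k} ?T)"
  proof (rule card_mono)
    show "finite (PiE {1..k} ?T)" by (intro finite_PiE) auto
    show "{m \<in> {1..k} \<rightarrow>\<^sub>E {1..N}. (\<forall>i\<in>{1..k}. m i \<le> m j) \<and> m j = t} \<subseteq> PiE {1..k} ?T"
      by (auto simp: PiE_iff extensional_def)
  qed
  also have "\<dots> = (\<Prod>i\<in>{1..k}. card (?T i))" by (simp add: card_PiE)
  also have "\<dots> = card (?T j) * (\<Prod>i\<in>{1..k} - {j}. card (?T i))"
    using assms by (intro prod.remove) auto
  also have "(\<Prod>i\<in>{1..k} - {j}. card (?T i)) = (\<Prod>i\<in>{1..k} - {j}. t)"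
    by (intro prod.cong) auto
  also have "\<dots> = t ^ (k - 1)" using assms by simp
  finally show ?thesis by simp
qed

text \<open>At most t^(k-1) points have \<open>m j = t\<close> as their largest coordinate, and each
  contributes t^(-k). The harmonic sum that remains is one of the sources of the logarithm for d =
  3.\<close>

lemma sum_dominated_coordinate_le:
  fixes k :: nat
  assumes "j \<in> {1..k}"
  shows "(\<Sum>m | m \<in> {1..k} \<rightarrow>\<^sub>E {1..N} \<and> (\<forall>i\<in>{1..k}. m i \<le> m j). real (m j) powr (- real k))
           \<le> (\<Sum>t=1..N. 1 / real t)"
proof -
  let ?E = "{m. m \<in> {1..k} \<rightarrow>\<^sub>E {1..N} \<and> (\<forall>i\<in>{1..k}. m i \<le> m j)}"
  have fin: "finite ?E" by (rule finite_subset[of _ "{1..k} \<rightarrow>\<^sub>E {1..N}"]) (auto intro: finite_PiE)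
  have "(\<Sum>m\<in>?E. real (m j) powr (- real k))
      = (\<Sum>t=1..N. \<Sum>m\<in>{m \<in> ?E. m j = t}. real (m j) powr (- real k))"
    using fin assms by (intro sum.group[symmetric]) auto
  also have "\<dots> \<le> (\<Sum>t=1..N. 1 / real t)"
  proof (rule sum_mono)
    fix t assume t: "t \<in> {1..N}"
    have "(\<Sum>m\<in>{m \<in> ?E. m j = t}. real (m j) powr (- real k))
        = (\<Sum>m\<in>{m \<in> ?E. m j = t}. real t powr (- real k))"
      by (intro sum.cong) auto
    also have "\<dots> = real (card {m \<in> ?E. m j = t}) * real t powr (- real k)" by simp
    also have "\<dots> \<le> real (t ^ (k - 1)) * real t powr (- real k)"
      using card_PiE_dominated_coordinate_le[OF assms, of N t]
      by (intro mult_right_mono) (auto simp: conj_assoc simp del: of_nat_power)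
    also have "\<dots> = real t ^ (k - 1) / real t ^ k"
      using t by (simp add: powr_minus powr_realpow divide_inverse)
    also have "\<dots> = 1 / real t"
      using t assms by (cases k) auto
    finally show "(\<Sum>m\<in>{m \<in> ?E. m j = t}. real (m j) powr (- real k)) \<le> 1 / real t" .
  qed
  finally show ?thesis .
qed

text \<open>The geometric mean of the bounds in the coordinates other than \<open>j\<close>; as a product, it can be
  summed over each coordinate separately.\<close>
lemma le_prod_powr_root:
  fixes K :: real
  assumes "finite J" "J \<noteq> {}" "0 \<le> K" "\<And>i. i \<in> J \<Longrightarrow> K \<le> x i powr (-\<beta>)" "\<And>i. i \<in> J \<Longrightarrow> 0 \<le> x i"
  shows "K \<le> (\<Prod>i\<in>J. x i powr (- (\<beta> / real (card J))))"
proof (cases "K = 0")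
  case False
  have card: "card J > 0" using assms by (simp add: card_gt_0_iff)
  have "K = (K powr (1 / real (card J))) ^ card J"
    using False assms(3) card by (simp add: powr_power)
  also have "\<dots> = (\<Prod>i\<in>J. K powr (1 / real (card J)))" by simp
  also have "\<dots> \<le> (\<Prod>i\<in>J. (x i powr (-\<beta>)) powr (1 / real (card J)))"
    using assms by (intro prod_mono conjI powr_mono2) auto
  finally show ?thesis by (simp add: powr_powr)
qed (simp add: prod_nonneg)

lemma half_square_powr:
  fixes x :: real
  assumes "0 < x" "\<kappa> = 2 * \<beta>"
  shows "(x\<^sup>2 / 2) powr (-\<beta>) = 2 powr \<beta> * x powr (-\<kappa>)"
proof -
  have "x\<^sup>2 = x powr 2" using assms by simp
  then have "(x\<^sup>2) powr (-\<beta>) = x powr (-\<kappa>)" unfolding assms(2) by (simp only: powr_powr) simp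
  moreover have "(x\<^sup>2 / 2) powr (-\<beta>) = (x\<^sup>2) powr (-\<beta>) / 2 powr (-\<beta>)"
    using assms by (simp add: powr_divide)
  ultimately show ?thesis by (simp add: powr_minus_divide[of 2])
qed

text \<open>\<open>K\<close> stands for the row of the kernel at \<open>n\<close>, with k = d - 1;
  \<open>K1\<close> and \<open>K2\<close> are the decay in a coordinate of m - n and in |m|^2 -
  |n|^2. The three summands on the right bound, in this order, the terms with widely different
  squared norms, the largest terms of the lines in direction j, and the tails of these lines. The
  outer factor counts the choices of j.\<close>

lemma row_sum_le:
  fixes K :: "(nat \<Rightarrow> nat) \<Rightarrow> real" and k N :: nat
  defines "F \<equiv> {1..k} \<rightarrow>\<^sub>E {1..N}"
  defines "sq \<equiv> \<lambda>m :: nat \<Rightarrow> nat. \<Sum>i=1..k. (real (m i))\<^sup>2"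
  assumes k: "k \<ge> 2" and n: "n \<in> F"
    and K0: "\<And>m. 0 \<le> K m"
    and K1: "\<And>m i. i \<in> {1..k} \<Longrightarrow> K m \<le> (1 + \<bar>real (n i) - real (m i)\<bar>) powr (- (real k / 2))"
    and K2: "\<And>m. K m \<le> (1 + \<bar>sq m - sq n\<bar>) powr (- (real k / 2))"
  shows "(\<Sum>m\<in>F. K m) \<le> real k * (2 powr (real k / 2) * (\<Sum>t=1..N. 1 / real t)
     + 2 * (2 * (\<Sum>v=1..2 * k * N. real v powr (- (real k / 2 / real (k - 1))))) ^ (k - 1)
     + 2 * (2 ^ (k - 1) * (real k + 1) powr (real k / 4) * real k powr (real k / 2 - 1))
         * real N powr (real k / 2 - 1) * (\<Sum>q=1..N. real q powr (- (real k / 2))))"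
proof -
  define \<beta> where "\<beta> = real k / 2"
  \<comment> \<open>The share of the decay exponent given to each of the k - 1 coordinates other
    than j by the geometric mean.\<close>
  define \<theta> where "\<theta> = \<beta> / real (k - 1)"
  define L where "L = sqrt (sq n)"
  \<comment> \<open>When |m|^2 and |n|^2 differ by less than m_j^2 / 2, with m_j the largest
    coordinate of m, one has L^2 \<le> (k + 1) m_j^2 and m_j^2 \<le> 2 L^2. Hence \<open>l\<close>
    bounds m_j from below and \<open>R\<close> bounds every coordinate of m from above;
    \<open>R\<close> bounds those of \<open>n\<close> as well.\<close>
  define l where "l = L / sqrt (real k + 1)"
  define R where "R = nat \<lfloor>2 * L\<rfloor>"
  have \<beta>: "\<beta> \<ge> 1" using k by (simp add: \<beta>_def)
  have nI: "n i \<in> {1..N}" if "i \<in> {1..k}" for i using n that unfolding F_def by auto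
  have finF: "finite F" unfolding F_def by (intro finite_PiE) auto
  have n_le_L: "real (n i) \<le> L" if "i \<in> {1..k}" for i
  proof -
    have "(real (n i))\<^sup>2 \<le> sq n" unfolding sq_def using that by (intro member_le_sum) auto
    then show ?thesis unfolding L_def by (rule real_le_rsqrt)
  qed
  have L1: "1 \<le> L" using n_le_L[of 1] nI[of 1] k by simp
  have LsqQ: "L\<^sup>2 = sq n" unfolding L_def sq_def by (simp add: sum_nonneg)
  have LN: "L \<le> real k * real N"
  proof -
    have "sq n \<le> (\<Sum>i=1..k. (real N)\<^sup>2)"
      unfolding sq_def using nI by (intro sum_mono power_mono) auto
    also have "\<dots> = real k * (real N)\<^sup>2" by simp
    also have "\<dots> \<le> (real k)\<^sup>2 * (real N)\<^sup>2"
      using k by (intro mult_right_mono) (auto simp: power2_eq_square)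
    finally show ?thesis unfolding L_def by (intro real_le_lsqrt) (auto simp: power_mult_distrib sum_nonneg sq_def)
  qed
  have l0: "0 < l" using L1 unfolding l_def by simp
  have RL: "real R \<le> 2 * L" unfolding R_def using L1 by simp
  have leR: "t \<le> R" if "real t \<le> 2 * L" for t unfolding R_def using that by (simp add: le_nat_floor)
  have RN: "R \<le> 2 * k * N"
  proof -
    have "real R \<le> real (2 * k * N)" using RL LN by simp
    then show ?thesis by (simp only: of_nat_le_iff)
  qed
  define V where "V = (\<Sum>v=1..2 * k * N. real v powr (-\<theta>))"
  define Z where "Z = (\<Sum>q=1..N. real q powr (-\<beta>))"
  define H where "H = (\<Sum>t=1..N. 1 / real t)"
  define c where "c = 2 ^ (k - 1) * (real k + 1) powr (real k / 4) * real k powr (\<beta> - 1)"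
  have Z0: "0 \<le> Z" unfolding Z_def by (intro sum_nonneg) auto
  \<comment> \<open>There are R^(k-1) lines with a tail of size l^(-k/2) Z each. As R and l are of
    order L at most and at least, this is of order L^(k/2-1) Z; the exponent is nonnegative, so L
    can be replaced by k N.\<close>
  have scale: "real R ^ (k - 1) * (\<Sum>q=1..N. (l * real q) powr (-\<beta>)) \<le> c * real N powr (\<beta> - 1) * Z"
  proof -
    have "real R ^ (k - 1) \<le> (2 * L) ^ (k - 1)" using RL by (intro power_mono) auto
    also have "\<dots> = 2 ^ (k - 1) * L powr real (k - 1)" using L1 by (simp add: power_mult_distrib powr_realpow)
    finally have 1: "real R ^ (k - 1) \<le> 2 ^ (k - 1) * L powr real (k - 1)" .
    have 2: "l powr (-\<beta>) = L powr (-\<beta>) * (real k + 1) powr (real k / 4)"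
    proof -
      have "sqrt (real k + 1) powr (-\<beta>) = ((real k + 1) powr (1 / 2)) powr (-\<beta>)"
        by (simp add: powr_half_sqrt)
      also have "\<dots> = inverse ((real k + 1) powr (real k / 4))"
        unfolding powr_powr by (simp add: \<beta>_def powr_minus)
      finally have "sqrt (real k + 1) powr (-\<beta>) = inverse ((real k + 1) powr (real k / 4))" .
      moreover have "l powr (-\<beta>) = L powr (-\<beta>) / sqrt (real k + 1) powr (-\<beta>)"
        unfolding l_def using L1 by (simp add: powr_divide)
      ultimately show ?thesis by (simp only: divide_inverse inverse_inverse_eq)
    qed
    have 3: "L powr real (k - 1) * L powr (-\<beta>) = L powr (\<beta> - 1)"
    proof -
      have "real (k - 1) + -\<beta> = \<beta> - 1" using k unfolding \<beta>_def by (simp add: of_nat_diff)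
      then show ?thesis by (simp only: powr_add[symmetric])
    qed
    have 4: "L powr (\<beta> - 1) \<le> real k powr (\<beta> - 1) * real N powr (\<beta> - 1)"
      using powr_mono2[of "\<beta> - 1" L "real k * real N"] LN L1 \<beta> by (simp add: powr_mult)
    have "real R ^ (k - 1) * l powr (-\<beta>)
        \<le> 2 ^ (k - 1) * L powr real (k - 1) * (L powr (-\<beta>) * (real k + 1) powr (real k / 4))"
      unfolding 2 using 1 by (intro mult_right_mono) auto
    also have "\<dots> = 2 ^ (k - 1) * (real k + 1) powr (real k / 4) * (L powr real (k - 1) * L powr (-\<beta>))"
      by (simp only: mult_ac)
    also have "\<dots> \<le> 2 ^ (k - 1) * (real k + 1) powr (real k / 4) * (real k powr (\<beta> - 1) * real N powr (\<beta> - 1))"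
      unfolding 3 using 4 by (intro mult_left_mono) auto
    also have "\<dots> = c * real N powr (\<beta> - 1)" unfolding c_def by (simp only: mult_ac)
    finally have "real R ^ (k - 1) * l powr (-\<beta>) \<le> c * real N powr (\<beta> - 1)" .
    then have "real R ^ (k - 1) * l powr (-\<beta>) * Z \<le> c * real N powr (\<beta> - 1) * Z"
      using Z0 by (rule mult_right_mono)
    moreover have "(\<Sum>q=1..N. (l * real q) powr (-\<beta>)) = l powr (-\<beta>) * Z"
      unfolding Z_def using l0 by (simp add: powr_mult sum_distrib_left)
    ultimately show ?thesis by (simp only: mult.assoc)
  qed
  \<comment> \<open>The sets \<open>E j\<close> overlap when the largest coordinate is not unique;
    as \<open>K\<close> is nonnegative, counting such points several times only enlarges the upper
    bound.\<close>
  define E where "E j = {m. m \<in> F \<and> (\<forall>i\<in>{1..k}. m i \<le> m j)}" for j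
  have EF: "E j \<subseteq> F" for j unfolding E_def by auto
  have finE: "finite (E j)" for j using EF finF by (rule finite_subset)
  have far: "(\<Sum>m | m \<in> E j \<and> (real (m j))\<^sup>2 / 2 \<le> \<bar>sq m - sq n\<bar>. K m) \<le> 2 powr \<beta> * H"
    if j: "j \<in> {1..k}" for j
  proof -
    let ?A = "{m. m \<in> E j \<and> (real (m j))\<^sup>2 / 2 \<le> \<bar>sq m - sq n\<bar>}"
    have "K m \<le> 2 powr \<beta> * real (m j) powr (- real k)" if m: "m \<in> ?A" for m
    proof -
      have mj: "real (m j) \<ge> 1" using m j unfolding E_def F_def by (auto simp: PiE_iff)
      have "K m \<le> (1 + \<bar>sq m - sq n\<bar>) powr (-\<beta>)" using K2 unfolding \<beta>_def .
      also have "\<dots> \<le> ((real (m j))\<^sup>2 / 2) powr (-\<beta>)"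
        using m mj \<beta> by (intro powr_mono2') auto
      also have "((real (m j))\<^sup>2 / 2) powr (-\<beta>) = 2 powr \<beta> * real (m j) powr (- real k)"
        using mj by (intro half_square_powr) (auto simp: \<beta>_def)
      finally show ?thesis .
    qed
    then have "(\<Sum>m\<in>?A. K m) \<le> (\<Sum>m\<in>?A. 2 powr \<beta> * real (m j) powr (- real k))" by (intro sum_mono)
    also have "\<dots> \<le> (\<Sum>m\<in>E j. 2 powr \<beta> * real (m j) powr (- real k))"
      using finE by (intro sum_mono2) auto
    also have "\<dots> = 2 powr \<beta> * (\<Sum>m\<in>E j. real (m j) powr (- real k))" by (simp add: sum_distrib_left)
    also have "\<dots> \<le> 2 powr \<beta> * H"
      using sum_dominated_coordinate_le[OF j, of N] unfolding H_def E_def F_def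
      by (intro mult_left_mono) auto
    finally show ?thesis .
  qed
  have near: "(\<Sum>m | m \<in> E j \<and> \<bar>sq m - sq n\<bar> < (real (m j))\<^sup>2 / 2. K m)
      \<le> 2 * (2 * V) ^ (k - 1) + 2 * c * real N powr (\<beta> - 1) * Z"
    if j: "j \<in> {1..k}" for j
  proof -
    let ?A = "{m. m \<in> E j \<and> \<bar>sq m - sq n\<bar> < (real (m j))\<^sup>2 / 2}"
    define S where "S = {t \<in> {1..N}. l \<le> real t}"
    define J where "J = {1..k} - {j}"
    define T where "T i = (if i = j then S else {1..R})" for i
    have J: "finite J" "j \<notin> J" "insert j J = {1..k}" "card J = k - 1" "J \<subseteq> {1..k}"
      using j unfolding J_def by auto
    have sqj: "sq m = (real (m j))\<^sup>2 + (\<Sum>i\<in>J. (real (m i))\<^sup>2)" for m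
      unfolding sq_def J_def using j by (intro sum.remove) auto
    \<comment> \<open>Keeping only the ranges of the single coordinates decouples them: the sum over
      m_j can then be done for fixed other coordinates, and the sum over the latter factors.\<close>
    have "?A \<subseteq> PiE {1..k} T"
    proof
      fix m assume m: "m \<in> ?A"
      then have mF: "m \<in> F" and mle: "\<And>i. i \<in> {1..k} \<Longrightarrow> m i \<le> m j" unfolding E_def by auto
      have low: "(real (m j))\<^sup>2 \<le> sq m" unfolding sq_def using j by (intro member_le_sum) auto
      have "sq m \<le> (\<Sum>i=1..k. (real (m j))\<^sup>2)"
        unfolding sq_def using mle by (intro sum_mono power_mono) auto
      then have up: "sq m \<le> real k * (real (m j))\<^sup>2" by simp
      have "L\<^sup>2 \<le> real k * (real (m j))\<^sup>2 + (real (m j))\<^sup>2"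
      proof -
        have "\<bar>sq m - sq n\<bar> < (real (m j))\<^sup>2 / 2" using m by simp
        moreover have "0 \<le> (real (m j))\<^sup>2" by simp
        ultimately show ?thesis using up unfolding LsqQ by linarith
      qed
      then have "L\<^sup>2 / (real k + 1) \<le> (real (m j))\<^sup>2" by (simp add: field_simps)
      then have "l\<^sup>2 \<le> (real (m j))\<^sup>2" unfolding l_def by (simp add: power_divide)
      then have lm: "l \<le> real (m j)" by (rule power2_le_imp_le) simp
      have "\<bar>sq m - sq n\<bar> < (real (m j))\<^sup>2 / 2" using m by simp
      then have "(real (m j))\<^sup>2 \<le> 2 * L\<^sup>2" using low unfolding LsqQ by linarith
      also have "\<dots> \<le> (2 * L)\<^sup>2" by (simp add: power_mult_distrib)
      finally have "real (m j) \<le> 2 * L" by (rule power2_le_imp_le) (use L1 in simp)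
      then have "m j \<le> R" by (rule leR)
      then have "m i \<in> T i" if "i \<in> {1..k}" for i
        using mF[unfolded F_def PiE_iff] mle[of i] lm that order_trans[of "m i" "m j" R]
        unfolding T_def S_def by auto
      moreover have "m \<in> extensional {1..k}" using mF unfolding F_def PiE_iff by blast
      ultimately show "m \<in> PiE {1..k} T" unfolding PiE_iff by blast
    qed
    then have "(\<Sum>m\<in>?A. K m) \<le> (\<Sum>m\<in>PiE {1..k} T. K m)"
      using K0 by (intro sum_mono2 finite_PiE) (auto simp: T_def S_def)
    also have "\<dots> = (\<Sum>g\<in>PiE J T. \<Sum>t\<in>S. K (g(j := t)))"
      using sum_PiE_insert[OF J(1,2), of K T] unfolding J(3) T_def by simp
    also have "PiE J T = PiE J (\<lambda>_. {1..R})"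
      using J(2) by (intro PiE_cong) (auto simp: T_def)
    also have "(\<Sum>g\<in>PiE J (\<lambda>_. {1..R}). \<Sum>t\<in>S. K (g(j := t)))
        \<le> (\<Sum>g\<in>PiE J (\<lambda>_. {1..R}). 2 * ((\<Prod>i\<in>J. (1 + \<bar>real (n i) - real (g i)\<bar>) powr (-\<theta>))
            + (\<Sum>q=1..N. (l * real q) powr (-\<beta>))))"
    proof (rule sum_mono)
      fix g :: "nat \<Rightarrow> nat"
      show "(\<Sum>t\<in>S. K (g(j := t))) \<le> 2 * ((\<Prod>i\<in>J. (1 + \<bar>real (n i) - real (g i)\<bar>) powr (-\<theta>))
            + (\<Sum>q=1..N. (l * real q) powr (-\<beta>)))"
      \<comment> \<open>Along the line, |m|^2 - |n|^2 is t^2 + T. The bound \<open>P\<close> on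
        single terms is the product over the other coordinates, which does not depend on t.\<close>
      proof (rule sum_near_square_le[where T = "(\<Sum>i\<in>J. (real (g i))\<^sup>2) - sq n"])
        fix t
        have "K (g(j := t)) \<le> (\<Prod>i\<in>J. (1 + \<bar>real (n i) - real ((g(j := t)) i)\<bar>) powr (- (\<beta> / real (card J))))"
        proof (rule le_prod_powr_root)
          fix i assume "i \<in> J"
          then show "K (g(j := t)) \<le> (1 + \<bar>real (n i) - real ((g(j := t)) i)\<bar>) powr (-\<beta>)"
            unfolding \<beta>_def using J(5) by (intro K1) auto
        next
          show "J \<noteq> {}" using J(4) k by auto
        qed (use J K0 in auto)
        also have "\<dots> = (\<Prod>i\<in>J. (1 + \<bar>real (n i) - real (g i)\<bar>) powr (-\<theta>))"
          unfolding J(4) \<theta>_def using J(2) by (intro prod.cong) auto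
        finally show "K (g(j := t)) \<le> (\<Prod>i\<in>J. (1 + \<bar>real (n i) - real (g i)\<bar>) powr (-\<theta>))" .
        have "(\<Sum>i\<in>J. (real ((g(j := t)) i))\<^sup>2) = (\<Sum>i\<in>J. (real (g i))\<^sup>2)"
          using J(2) by (intro sum.cong) auto
        then have "sq (g(j := t)) = (real t)\<^sup>2 + (\<Sum>i\<in>J. (real (g i))\<^sup>2)"
          using sqj[of "g(j := t)"] by simp
        then show "K (g(j := t)) \<le> (1 + \<bar>(real t)\<^sup>2 + ((\<Sum>i\<in>J. (real (g i))\<^sup>2) - sq n)\<bar>) powr (-\<beta>)"
          using K2[of "g(j := t)"] by (simp add: \<beta>_def add_diff_eq)
      qed (use l0 \<beta> in \<open>auto simp: S_def intro: prod_nonneg\<close>)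
    qed
    also have "\<dots> = 2 * (\<Sum>g\<in>PiE J (\<lambda>_. {1..R}). \<Prod>i\<in>J. (1 + \<bar>real (n i) - real (g i)\<bar>) powr (-\<theta>))
        + 2 * (real R ^ (k - 1) * (\<Sum>q=1..N. (l * real q) powr (-\<beta>)))"
      using J by (simp add: sum.distrib sum_distrib_left card_PiE mult.left_commute)
    also have "(\<Sum>g\<in>PiE J (\<lambda>_. {1..R}). \<Prod>i\<in>J. (1 + \<bar>real (n i) - real (g i)\<bar>) powr (-\<theta>))
        = (\<Prod>i\<in>J. \<Sum>u=1..R. (1 + \<bar>real (n i) - real u\<bar>) powr (-\<theta>))"
      using J by (intro prod_sum_PiE[symmetric]) auto
    also have "\<dots> \<le> (\<Prod>i\<in>J. 2 * V)"
    proof (intro prod_mono conjI)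
      fix i assume i: "i \<in> J"
      have "n i \<le> R" using i J(5) n_le_L[of i] L1 by (intro leR) auto
      then have "(\<Sum>u=1..R. (1 + \<bar>real (n i) - real u\<bar>) powr (-\<theta>)) \<le> 2 * (\<Sum>v=1..R. real v powr (-\<theta>))"
        using nI[of i] i J(5) by (intro sum_dist_powr_le) auto
      also have "\<dots> \<le> 2 * V"
        unfolding V_def using RN by (intro mult_left_mono sum_mono2) auto
      finally show "(\<Sum>u=1..R. (1 + \<bar>real (n i) - real u\<bar>) powr (-\<theta>)) \<le> 2 * V" .
    qed (auto intro: sum_nonneg)
    also have "\<dots> = (2 * V) ^ (k - 1)" using J by simp
    finally show ?thesis using scale by (simp add: algebra_simps)
  qed
  have "F \<subseteq> (\<Union>j\<in>{1..k}. E j)"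
  proof
    fix m assume m: "m \<in> F"
    have "Max (m ` {1..k}) \<in> m ` {1..k}" using k by (intro Max_in) auto
    then obtain j where j: "j \<in> {1..k}" "m j = Max (m ` {1..k})" by auto
    then have "m \<in> E j" using m unfolding E_def by auto
    with j show "m \<in> (\<Union>j\<in>{1..k}. E j)" by blast
  qed
  then have "(\<Sum>m\<in>F. K m) \<le> (\<Sum>m\<in>F. \<Sum>j=1..k. if m \<in> E j then K m else 0)"
  proof (intro sum_mono)
    fix m assume "m \<in> F"
    then obtain j where j: "j \<in> {1..k}" "m \<in> E j" using \<open>F \<subseteq> (\<Union>j\<in>{1..k}. E j)\<close> by blast
    have "(if m \<in> E j then K m else 0) \<le> (\<Sum>j=1..k. if m \<in> E j then K m else 0)"
      using K0 j(1) by (intro member_le_sum) auto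
    then show "K m \<le> (\<Sum>j=1..k. if m \<in> E j then K m else 0)" using j(2) by simp
  qed
  also have "\<dots> = (\<Sum>j=1..k. \<Sum>m\<in>E j. K m)"
  proof (subst sum.swap, rule sum.cong[OF refl])
    fix j
    have "(\<Sum>m\<in>F. if m \<in> E j then K m else 0) = (\<Sum>m\<in>{m \<in> F. m \<in> E j}. K m)"
      using finF by (intro sum.inter_filter[symmetric])
    also have "{m \<in> F. m \<in> E j} = E j" using EF by auto
    finally show "(\<Sum>m\<in>F. if m \<in> E j then K m else 0) = sum K (E j)" .
  qed
  also have "\<dots> \<le> (\<Sum>j=1..k. 2 powr \<beta> * H + 2 * (2 * V) ^ (k - 1) + 2 * c * real N powr (\<beta> - 1) * Z)"
  proof (rule sum_mono)
    fix j assume j: "j \<in> {1..k}"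
    let ?A = "{m. m \<in> E j \<and> (real (m j))\<^sup>2 / 2 \<le> \<bar>sq m - sq n\<bar>}"
    let ?A' = "{m. m \<in> E j \<and> \<bar>sq m - sq n\<bar> < (real (m j))\<^sup>2 / 2}"
    have "finite ?A" "finite ?A'" using finE by (auto intro: finite_subset[of _ "E j"])
    then have "sum K (?A \<union> ?A') = sum K ?A + sum K ?A'" by (intro sum.union_disjoint) auto
    moreover have "?A \<union> ?A' = E j" by auto
    ultimately have "sum K (E j) = sum K ?A + sum K ?A'" by simp
    then show "sum K (E j) \<le> 2 powr \<beta> * H + 2 * (2 * V) ^ (k - 1) + 2 * c * real N powr (\<beta> - 1) * Z"
      using far[OF j] near[OF j] by simp
  qed
  also have "\<dots> = real k * (2 powr \<beta> * H + 2 * (2 * V) ^ (k - 1) + 2 * c * real N powr (\<beta> - 1) * Z)"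
    by (simp only: sum_constant card_atLeastAtMost diff_Suc_1)
  finally show ?thesis
    unfolding V_def Z_def H_def c_def \<theta>_def \<beta>_def .
qed

text \<open>Without the weight, the range t > 2n contributes about ln (N / n), since the bound on
  \<open>K t\<close> is of size 1/t there. The weight turns this into a tail of t^(-3/2). For t <
  n/2 one has \<open>K t\<close> \<le> 2/n, and the weights add up to at most 2 n^(1/2). Around n
  the unweighted sum is bounded and the weight is comparable to n^(-1/2). The constant is 4 + 4 +
  20.\<close>

lemma row_sum_le_one_dim:
  fixes K :: "nat \<Rightarrow> real"
  assumes n: "n \<ge> 1" and K0: "\<And>t. 0 \<le> K t"
    and K: "\<And>t. K t \<le> (1 + \<bar>(real t)\<^sup>2 - (real n)\<^sup>2\<bar>) powr (-1/2)"
  shows "(\<Sum>t=1..N. K t * real t powr (-1/2)) \<le> 28 * real n powr (-1/2)"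
proof -
  let ?f = "\<lambda>t. K t * real t powr (-1/2)"
  define s where "s = real n powr (-1/2)"
  have nn: "real n powr (1/2) = real n * s"
  proof -
    have "real n * s = real n powr (1 + -1/2)" unfolding powr_add s_def using n by simp
    then show ?thesis by simp
  qed
  have K_far: "K t \<le> 2 / x" if "0 < x" "x\<^sup>2 / 4 \<le> \<bar>(real t)\<^sup>2 - (real n)\<^sup>2\<bar>" for x t
  proof -
    have "K t \<le> (1 + \<bar>(real t)\<^sup>2 - (real n)\<^sup>2\<bar>) powr (-1/2)" by (rule K)
    also have "\<dots> \<le> ((x / 2)\<^sup>2) powr (-1/2)"
      using that by (intro powr_mono2') (auto simp: power_divide)
    also have "\<dots> = (x / 2) powr (-1)"
    proof -
      have "(x / 2)\<^sup>2 = (x / 2) powr 2" using that by simp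
      then show ?thesis by (simp only: powr_powr) simp
    qed
    also have "\<dots> = 2 / x" using that by (simp add: powr_neg_one)
    finally show ?thesis .
  qed
  let ?A = "{t \<in> {1..N}. 2 * t < n}" and ?B = "{t \<in> {1..N}. 2 * n < t}"
    and ?C = "{t \<in> {1..N}. n \<le> 2 * t \<and> t \<le> 2 * n}"
  have "sum ?f ?A \<le> (\<Sum>t\<in>?A. 2 / real n * real t powr (-(1/2)))"
  proof (rule sum_mono)
    fix t assume t: "t \<in> ?A"
    have "(2 * real t)\<^sup>2 \<le> (real n)\<^sup>2" using t by (intro power_mono) auto
    then have "4 * (real t)\<^sup>2 \<le> (real n)\<^sup>2" by (simp add: power_mult_distrib)
    then have "(real n)\<^sup>2 / 4 \<le> \<bar>(real t)\<^sup>2 - (real n)\<^sup>2\<bar>"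
      using zero_le_power2[of "real n"] by linarith
    then have "K t \<le> 2 / real n" using n by (intro K_far) auto
    then have "?f t \<le> 2 / real n * real t powr (-1/2)" by (rule mult_right_mono) auto
    then show "?f t \<le> 2 / real n * real t powr (-(1/2))" by simp
  qed
  also have "\<dots> = 2 / real n * (\<Sum>t\<in>?A. real t powr (-(1/2)))" by (simp add: sum_distrib_left)
  also have "(\<Sum>t\<in>?A. real t powr (-(1/2))) \<le> (\<Sum>t=1..n. real t powr (-(1/2)))"
    by (intro sum_mono2) auto
  also have "\<dots> \<le> real n powr (1 - 1/2) / (1 - 1/2)" by (rule sum_powr_neg_le) auto
  finally have A: "sum ?f ?A \<le> 4 * s" using n nn by (simp add: field_simps)
  have "sum ?f ?B \<le> (\<Sum>t\<in>?B. 2 * real t powr (-3/2))"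
  proof (rule sum_mono)
    fix t assume t: "t \<in> ?B"
    have "(2 * real n)\<^sup>2 \<le> (real t)\<^sup>2" using t by (intro power_mono) auto
    then have "4 * (real n)\<^sup>2 \<le> (real t)\<^sup>2" by (simp add: power_mult_distrib)
    then have "(real t)\<^sup>2 / 4 \<le> \<bar>(real t)\<^sup>2 - (real n)\<^sup>2\<bar>"
      using zero_le_power2[of "real t"] by linarith
    then have "K t \<le> 2 / real t" using t by (intro K_far) auto
    then have "?f t \<le> 2 / real t * real t powr (-1/2)" by (rule mult_right_mono) auto
    also have "\<dots> = 2 * (real t powr (-1) * real t powr (-1/2))"
      using t by (simp add: powr_neg_one)
    also have "real t powr (-1) * real t powr (-1/2) = real t powr (-1 + -1/2)"
      by (rule powr_add[symmetric])
    also have "(-1 + -1/2 :: real) = -3/2" by simp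
    finally show "?f t \<le> 2 * real t powr (-3/2)" .
  qed
  also have "\<dots> = 2 * (\<Sum>t\<in>?B. real t powr (-3/2))" by (simp add: sum_distrib_left)
  also have "(\<Sum>t\<in>?B. real t powr (-3/2)) \<le> (\<Sum>t\<in>{n<..N}. real t powr (-3/2))"
    by (intro sum_mono2) auto
  also have "\<dots> \<le> 2 * real n powr (-1/2)" by (rule sum_powr_minus_three_halves_le[OF n])
  finally have B: "sum ?f ?B \<le> 4 * s" by (simp add: s_def)
  \<comment> \<open>The middle range lies in 1..2n and above n/2, so the squares have gaps at least
    n/2 and at most 2n multiples occur. This makes the bound independent of
    \<open>N\<close>.\<close>
  have C1: "(\<Sum>t\<in>?C. K t) \<le> 2 * (1 + (\<Sum>q=1..2 * n. (real n / 2 * real q) powr (-(1/2))))"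
  proof (rule sum_near_square_le[where T = "- (real n)\<^sup>2"])
    fix t
    have "K t \<le> (1 + \<bar>(real t)\<^sup>2 - (real n)\<^sup>2\<bar>) powr (-1/2)" by (rule K)
    then show "K t \<le> (1 + \<bar>(real t)\<^sup>2 + - (real n)\<^sup>2\<bar>) powr (-(1/2))" by simp
    have "(1 + \<bar>(real t)\<^sup>2 - (real n)\<^sup>2\<bar>) powr (-1/2) \<le> 1 powr (-1/2)" by (rule powr_mono2') auto
    then show "K t \<le> 1" using K[of t] by simp
  qed (use n in auto)
  have "(\<Sum>q=1..2 * n. (real n / 2 * real q) powr (-(1/2)))
      = (real n / 2) powr (-(1/2)) * (\<Sum>q=1..2 * n. real q powr (-(1/2)))"
    unfolding sum_distrib_left by (intro sum.cong refl powr_mult)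
  also have "\<dots> \<le> (real n / 2) powr (-(1/2)) * (real (2 * n) powr (1 - 1/2) / (1 - 1/2))"
    by (intro mult_left_mono sum_powr_neg_le) auto
  also have "real (2 * n) powr (1 - 1/2) = 2 * (real n / 2) powr (1/2)"
  proof -
    have "real (2 * n) = 4 * (real n / 2)" by simp
    then have "real (2 * n) powr (1/2) = 4 powr (1/2) * (real n / 2) powr (1/2)"
      by (simp only: powr_mult)
    moreover have "(4::real) powr (1/2) = 2" by (simp add: powr_half_sqrt)
    ultimately show ?thesis by simp
  qed
  also have "(real n / 2) powr (-(1/2)) * (2 * (real n / 2) powr (1/2) / (1 - 1/2))
      = 4 * ((real n / 2) powr (-(1/2)) * (real n / 2) powr (1/2))" by simp
  also have "(real n / 2) powr (-(1/2)) * (real n / 2) powr (1/2) = 1"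
    using n by (simp flip: powr_add)
  finally have C2: "(\<Sum>t\<in>?C. K t) \<le> 10" using C1 by simp
  have "sum ?f ?C \<le> (\<Sum>t\<in>?C. K t * (2 * s))"
  proof (intro sum_mono mult_left_mono K0)
    fix t assume t: "t \<in> ?C"
    \<comment> \<open>Although t \<ge> n/2, the weaker bound n/4 is used so that the factor is the
      rational number 2.\<close>
    have "real t powr (-1/2) \<le> (real n / 4) powr (-1/2)"
      using t n by (intro powr_mono2') auto
    also have "\<dots> = real n powr (-1/2) / 4 powr (-1/2)" by (simp add: powr_divide)
    also have "(4::real) powr (-1/2) = 1 / 2"
    proof -
      have "(4::real) powr (-1/2) = (2 powr 2) powr (-1/2)" by simp
      then show ?thesis by (simp only: powr_powr) (simp add: powr_neg_one)
    qed
    finally show "real t powr (-1/2) \<le> 2 * s" by (simp add: s_def)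
  qed
  also have "\<dots> = (\<Sum>t\<in>?C. K t) * (2 * s)" by (simp add: sum_distrib_right)
  also have "\<dots> \<le> 10 * (2 * s)" using C2 by (intro mult_right_mono) (auto simp: s_def)
  finally have C: "sum ?f ?C \<le> 20 * s" by simp
  have "sum ?f {1..N} = sum ?f (?A \<union> (?B \<union> ?C))" by (rule arg_cong[where f = "sum ?f"]) auto
  also have "\<dots> = sum ?f ?A + sum ?f (?B \<union> ?C)" by (intro sum.union_disjoint) auto
  also have "sum ?f (?B \<union> ?C) = sum ?f ?B + sum ?f ?C" by (intro sum.union_disjoint) auto
  finally show ?thesis using A B C by (simp add: s_def)
qed

text \<open>The exponent 3/2 is k/2 for k = 3, the first dimension in which the tails of the lines
  converge.\<close>

lemma powr_neg_sum_le_3: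
  assumes "\<beta> \<ge> 3 / 2"
  shows "(\<Sum>q=1..N. real q powr (-\<beta>)) \<le> 3"
proof -
  have "(\<Sum>q=1..N. real q powr (-\<beta>)) \<le> (\<Sum>q=1..N. real q powr (-3/2))"
    using assms by (intro sum_mono powr_mono) auto
  also have "\<dots> \<le> (\<Sum>q\<in>{1} \<union> {1<..N}. real q powr (-3/2))" by (intro sum_mono2) auto
  also have "\<dots> = 1 + (\<Sum>q\<in>{1<..N}. real q powr (-3/2))" by (subst sum.union_disjoint) auto
  also have "\<dots> \<le> 1 + 2 * real 1 powr (-1/2)"
    by (intro add_left_mono sum_powr_minus_three_halves_le) simp
  finally show ?thesis by simp
qed

text \<open>Lets constants be absorbed into the logarithm when d = 3. The value 1/2 comes from ln x
  \<le> x - 1 at x = 1/2.\<close>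

lemma half_le_ln: "N \<ge> 2 \<Longrightarrow> 1 / 2 \<le> ln (real N)"
proof -
  assume "N \<ge> 2"
  then have "ln 2 \<le> ln (real N)" by simp
  moreover have "ln (1 / 2 :: real) \<le> 1 / 2 - 1" by (rule ln_le_minus_one) simp
  ultimately show "1 / 2 \<le> ln (real N)" by (simp add: ln_div)
qed

text \<open>The case k = 2 is critical: k/2 and k/(2(k-1)) both equal 1, so \<open>H\<close>,
  \<open>V\<close> and \<open>Z\<close> are harmonic sums and each gives ln N. For k \<ge> 3 both
  the product of the one-dimensional sums and the tails have order N^(k/2-1), which also absorbs the
  logarithm in \<open>H\<close>.\<close>

lemma row_sum_le_B:
  fixes k :: nat
  assumes k: "k \<ge> 2"
  shows "\<exists>A. \<forall>N\<ge>2. \<forall>n\<in>{1..k} \<rightarrow>\<^sub>E {1..N}. \<forall>K :: (nat \<Rightarrow> nat) \<Rightarrow> real.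
      (\<forall>m. 0 \<le> K m) \<and>
      (\<forall>m. \<forall>i\<in>{1..k}. K m \<le> (1 + \<bar>real (n i) - real (m i)\<bar>) powr (- (real k / 2))) \<and>
      (\<forall>m. K m \<le> (1 + \<bar>(\<Sum>i=1..k. (real (m i))\<^sup>2) - (\<Sum>i=1..k. (real (n i))\<^sup>2)\<bar>) powr (- (real k / 2)))
      \<longrightarrow> (\<Sum>m\<in>{1..k} \<rightarrow>\<^sub>E {1..N}. K m) \<le> A * B (Suc k) N"
proof -
  define H where "H N = (\<Sum>t=1..N. 1 / real t)" for N :: nat
  define V where "V N = (\<Sum>v=1..2 * k * N. real v powr (- (real k / 2 / real (k - 1))))" for N
  define Z where "Z N = (\<Sum>q=1..N. real q powr (- (real k / 2)))" for N :: nat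
  define c where "c = 2 ^ (k - 1) * (real k + 1) powr (real k / 4) * real k powr (real k / 2 - 1)"
  have c0: "0 \<le> c" unfolding c_def by simp
  define rhs where "rhs N = real k * (2 powr (real k / 2) * H N + 2 * (2 * V N) ^ (k - 1)
     + 2 * c * real N powr (real k / 2 - 1) * Z N)" for N
  have "\<exists>A. \<forall>N\<ge>2. rhs N \<le> A * B (Suc k) N"
  proof (cases "k = 2")
    case True
    have "rhs N \<le> (2 * (26 + 6 * c)) * B (Suc k) N" if N: "N \<ge> 2" for N
    proof -
      have ln: "1 \<le> 2 * ln (real N)" using half_le_ln[OF N] by simp
      have H: "H N \<le> 3 * ln (real N)" using sum_inverse_le_ln[of N] N ln unfolding H_def by simp
      have Z: "Z N = H N" unfolding Z_def H_def True by (intro sum.cong) (auto simp: powr_neg_one)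
      have "V N = (\<Sum>v=1..4 * N. 1 / real v)"
        unfolding V_def True by (intro sum.cong) (auto simp: powr_neg_one)
      also have "\<dots> \<le> 1 + ln (real (4 * N))" using N by (intro sum_inverse_le_ln) auto
      also have "\<dots> = 1 + ln (2 ^ 2) + ln (real N)" using N by (simp add: ln_mult)
      also have "ln (2 ^ 2 :: real) = 2 * ln 2" by (subst ln_realpow) auto
      also have "ln (2 :: real) \<le> ln (real N)" using N by simp
      finally have V: "V N \<le> 5 * ln (real N)" using ln by simp
      have "rhs N = 2 * (2 * H N + 4 * V N + 2 * (c * H N))"
        unfolding rhs_def Z using N by (simp add: True)
      also have "\<dots> \<le> 2 * (2 * (3 * ln (real N)) + 4 * (5 * ln (real N)) + 2 * (c * (3 * ln (real N))))"
        using H V c0 by (intro mult_left_mono add_mono) auto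
      also have "\<dots> = (2 * (26 + 6 * c)) * ln (real N)" by (simp add: algebra_simps)
      also have "ln (real N) = B (Suc k) N" using N by (simp add: B_def True)
      finally show ?thesis .
    qed
    then show ?thesis by blast
  next
    case False
    with k have k3: "k \<ge> 3" by simp
    define \<theta> where "\<theta> = real k / 2 / real (k - 1)"
    have \<theta>: "0 \<le> \<theta>" "\<theta> < 1" using k3 unfolding \<theta>_def by (auto simp: field_simps of_nat_diff)
    define r where "r = (2 / (1 - \<theta>)) ^ (k - 1) * (2 * real k) powr (real k / 2 - 1)"
    have "rhs N \<le> (real k * (2 powr (real k / 2) * 2 + 2 * r + 2 * c * 3)) * B (Suc k) N" if N: "N \<ge> 2" for N
    proof -
      define X where "X = real N powr (real k / 2 - 1)"
      have X: "B (Suc k) N = X"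
      proof -
        have "(real (Suc k) - 3) / 2 = real k / 2 - 1" by simp
        then show ?thesis using k3 by (simp add: B_def X_def diff_divide_distrib)
      qed
      have "H N \<le> 1 + ln (real N)" using N unfolding H_def by (intro sum_inverse_le_ln) auto
      \<comment> \<open>The logarithm is bounded by 2 N^(1/2), and 1/2 \<le> k/2 - 1 because k \<ge>
        3.\<close>
      also have "ln (real N) = 2 * ln (sqrt (real N))" using N by (simp add: ln_sqrt)
      also have "ln (sqrt (real N)) \<le> sqrt (real N) - 1" using N by (intro ln_le_minus_one) auto
      also have "1 + 2 * (sqrt (real N) - 1) \<le> 2 * sqrt (real N)" by simp
      also have "sqrt (real N) = real N powr (1/2)" by (simp add: powr_half_sqrt)
      also have "2 * real N powr (1/2) \<le> 2 * X" unfolding X_def using N k3 by (simp add: powr_mono)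
      finally have H: "H N \<le> 2 * X" by simp
      have Z: "Z N \<le> 3" unfolding Z_def using k3 by (intro powr_neg_sum_le_3) auto
      have V0: "0 \<le> V N" unfolding V_def by (intro sum_nonneg) auto
      have "V N \<le> real (2 * k * N) powr (1 - \<theta>) / (1 - \<theta>)"
        unfolding V_def \<theta>_def[symmetric] by (rule sum_powr_neg_le[OF \<theta>])
      then have "(2 * V N) ^ (k - 1) \<le> (2 / (1 - \<theta>) * real (2 * k * N) powr (1 - \<theta>)) ^ (k - 1)"
        using V0 \<theta> by (intro power_mono) auto
      also have "\<dots> = (2 / (1 - \<theta>)) ^ (k - 1) * (real (2 * k * N) powr (1 - \<theta>)) ^ (k - 1)"
        by (rule power_mult_distrib)
      also have "(real (2 * k * N) powr (1 - \<theta>)) ^ (k - 1) = real (2 * k * N) powr ((1 - \<theta>) * real (k - 1))"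
        using k3 N by (simp add: powr_powr flip: powr_realpow)
      \<comment> \<open>The k - 1 sums of size N^(1-\<theta>) multiply to exactly the power of N in
        \<open>B\<close>.\<close>
      also have "(1 - \<theta>) * real (k - 1) = real k / 2 - 1"
        using k3 unfolding \<theta>_def by (simp add: field_simps of_nat_diff)
      also have "real (2 * k * N) powr (real k / 2 - 1) = (2 * real k) powr (real k / 2 - 1) * X"
        unfolding X_def by (simp add: powr_mult)
      finally have V: "(2 * V N) ^ (k - 1) \<le> r * X" unfolding r_def by simp
      have "rhs N \<le> real k * (2 powr (real k / 2) * (2 * X) + 2 * (r * X) + 2 * c * X * 3)"
        unfolding rhs_def X_def[symmetric] using H V Z c0
        by (intro mult_left_mono add_mono) (auto simp: X_def)
      then show ?thesis unfolding X by (simp add: algebra_simps)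
    qed
    then show ?thesis by blast
  qed
  then obtain A where A: "\<And>N. N \<ge> 2 \<Longrightarrow> rhs N \<le> A * B (Suc k) N" by blast
  show ?thesis
  proof (intro exI[of _ A] allI ballI impI, elim conjE)
    fix N :: nat and n and K :: "(nat \<Rightarrow> nat) \<Rightarrow> real"
    assume N: "2 \<le> N" and n: "n \<in> {1..k} \<rightarrow>\<^sub>E {1..N}" and "\<forall>m. 0 \<le> K m"
      "\<forall>m. \<forall>i\<in>{1..k}. K m \<le> (1 + \<bar>real (n i) - real (m i)\<bar>) powr (- (real k / 2))"
      "\<forall>m. K m \<le> (1 + \<bar>(\<Sum>i=1..k. (real (m i))\<^sup>2) - (\<Sum>i=1..k. (real (n i))\<^sup>2)\<bar>) powr (- (real k / 2))"
    then have "(\<Sum>m\<in>{1..k} \<rightarrow>\<^sub>E {1..N}. K m) \<le> rhs N"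
      unfolding rhs_def H_def V_def Z_def c_def by (intro row_sum_le[OF k n]) auto
    then show "(\<Sum>m\<in>{1..k} \<rightarrow>\<^sub>E {1..N}. K m) \<le> A * B (Suc k) N" using A[OF N] by simp
  qed
qed

subsection \<open>The quadratic form\<close>

lemma e_add: "e (s + t) = e s * e t"
  unfolding e_def by (simp add: distrib_left exp_add)

lemma e_0 [simp]: "e 0 = 1"
  by (simp add: e_def)

lemma cnj_e: "cnj (e t) = e (- t)"
  unfolding e_def by (simp add: exp_cnj)

lemma norm_e [simp]: "cmod (e t) = 1"
  unfolding e_def using norm_exp_i_times[of "2 * pi * t"] by (simp add: mult_ac)

lemma e_sum: "finite A \<Longrightarrow> e (\<Sum>i\<in>A. f i) = (\<Prod>i\<in>A. e (f i))"
  by (induction rule: finite_induct) (auto simp: e_add)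

lemma borel_measurable_e [measurable]: "e \<in> borel_measurable borel"
  unfolding e_def by (intro borel_measurable_continuous_onI continuous_intros)

lemma abs_le_L2_set:
  assumes "finite A" "i \<in> A"
  shows "\<bar>f i\<bar> \<le> L2_set f A"
proof -
  have "(f i)\<^sup>2 \<le> (\<Sum>i\<in>A. (f i)\<^sup>2)" using assms by (intro member_le_sum) auto
  then show ?thesis unfolding L2_set_def using real_sqrt_le_mono by fastforce
qed

lemma finite_frequencies: "finite (frequencies d N)"
  unfolding frequencies_def by (intro finite_PiE) auto

definition phase :: "nat \<Rightarrow> (nat \<Rightarrow> nat) \<Rightarrow> (nat \<Rightarrow> real) \<Rightarrow> real" where
  "phase d n x = (\<Sum>i=1..d-1. real (n i) * x i) + (\<Sum>i=1..d-1. (real (n i))\<^sup>2) * x d"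

text \<open>The frequency at which the entry (n, m) of the quadratic form samples the Fourier
  transform. The order is m minus n because \<open>fourier_coeff\<close> integrates e(-\<xi> x); the
  restricted lambda puts it in the function space over which \<open>fourier_decay\<close>
  quantifies.\<close>

definition phase_difference :: "nat \<Rightarrow> (nat \<Rightarrow> nat) \<Rightarrow> (nat \<Rightarrow> nat) \<Rightarrow> nat \<Rightarrow> int" where
  "phase_difference d n m = (\<lambda>i\<in>{1..d}. if i < d then int (m i) - int (n i)
     else (\<Sum>i=1..d-1. (int (m i))\<^sup>2) - (\<Sum>i=1..d-1. (int (n i))\<^sup>2))"

lemma phase_difference_funcset: "phase_difference d n m \<in> {1..d} \<rightarrow>\<^sub>E UNIV"
  unfolding phase_difference_def by simp

lemma phase_difference_simps:
  "i \<in> {1..d - 1} \<Longrightarrow> real_of_int (phase_difference d n m i) = real (m i) - real (n i)"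
  "d \<ge> 1 \<Longrightarrow> real_of_int (phase_difference d n m d)
     = (\<Sum>i=1..d-1. (real (m i))\<^sup>2) - (\<Sum>i=1..d-1. (real (n i))\<^sup>2)"
  unfolding phase_difference_def by auto

lemma phase_diff:
  assumes "d \<ge> 1"
  shows "phase d n x - phase d m x = - (\<Sum>i=1..d. of_int (phase_difference d n m i) * x i)"
proof -
  have "{1..d} = insert d {1..d-1}" using assms by auto
  moreover have "d \<notin> {1..d-1}" using assms by auto
  ultimately have "(\<Sum>i=1..d. of_int (phase_difference d n m i) * x i)
      = of_int (phase_difference d n m d) * x d + (\<Sum>i=1..d-1. of_int (phase_difference d n m i) * x i)"
    by simp
  also have "(\<Sum>i=1..d-1. of_int (phase_difference d n m i) * x i)
      = (\<Sum>i=1..d-1. (real (m i) - real (n i)) * x i)"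
    by (intro sum.cong refl) (simp only: phase_difference_simps)
  finally show ?thesis
    unfolding phase_def by (simp only: phase_difference_simps(2)[OF assms])
      (simp add: algebra_simps sum_subtractf)
qed

lemma L2_phase_difference_sym:
  "L2_set (\<lambda>i. of_int (phase_difference d n m i)) {1..d}
     = L2_set (\<lambda>i. of_int (phase_difference d m n i)) {1..d}"
proof -
  have "phase_difference d n m i = - phase_difference d m n i" if "i \<in> {1..d}" for i
    using that unfolding phase_difference_def by simp
  then show ?thesis unfolding L2_set_def by simp
qed

lemma torus_component_measurable [measurable]:
  assumes "torus_measure d \<sigma>" "i \<in> {1..d}"
  shows "(\<lambda>x. x i) \<in> borel_measurable \<sigma>"
proof -
  have "(\<lambda>x. x i) \<in> torus d \<rightarrow>\<^sub>M restrict_space borel {0..<1}"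
    unfolding torus_def using assms(2) by (rule measurable_component_singleton)
  then have "(\<lambda>x. x i) \<in> borel_measurable (torus d)"
    by (simp add: measurable_restrict_space2_iff)
  moreover have "sets \<sigma> = sets (torus d)" using assms(1) by (simp add: torus_measure_def)
  ultimately show ?thesis using measurable_cong_sets by blast
qed

lemma integrable_e_phase:
  assumes "torus_measure d \<sigma>"
  shows "integrable \<sigma> (\<lambda>x. e (- (\<Sum>i=1..d. of_int (\<xi> i) * x i)))"
proof -
  interpret finite_measure \<sigma> using assms by (simp add: torus_measure_def)
  have "(\<lambda>x. \<Sum>i=1..d. of_int (\<xi> i) * x i) \<in> borel_measurable \<sigma>"
    by (intro borel_measurable_sum borel_measurable_times borel_measurable_const
          torus_component_measurable[OF assms])
  then have "(\<lambda>x. e (- (\<Sum>i=1..d. of_int (\<xi> i) * x i))) \<in> borel_measurable \<sigma>"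
    by measurable
  then show ?thesis by (intro integrable_const_bound[where B = 1]) auto
qed

lemma integral_parabolic_sum:
  assumes "torus_measure d \<sigma>" "d \<ge> 1"
  shows "complex_of_real (LINT x|\<sigma>. (cmod (parabolic_sum a d x N))\<^sup>2)
    = (\<Sum>n\<in>frequencies d N. \<Sum>m\<in>frequencies d N.
         a n * cnj (a m) * fourier_coeff d \<sigma> (phase_difference d n m))"
proof -
  let ?F = "frequencies d N"
  have S: "complex_of_real ((cmod (parabolic_sum a d x N))\<^sup>2)
    = (\<Sum>n\<in>?F. \<Sum>m\<in>?F. a n * cnj (a m) * e (- (\<Sum>i=1..d. of_int (phase_difference d n m i) * x i)))" for x
  proof -
    have "parabolic_sum a d x N = (\<Sum>n\<in>?F. a n * e (phase d n x))"
      unfolding parabolic_sum_def phase_def ..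
    then have "complex_of_real ((cmod (parabolic_sum a d x N))\<^sup>2)
        = (\<Sum>n\<in>?F. a n * e (phase d n x)) * (\<Sum>m\<in>?F. cnj (a m) * e (- phase d m x))"
      by (simp only: complex_norm_square cnj_sum complex_cnj_mult cnj_e)
    also have "\<dots> = (\<Sum>n\<in>?F. \<Sum>m\<in>?F. a n * cnj (a m) * e (phase d n x + - phase d m x))"
      unfolding sum_product e_add by (simp add: mult_ac)
    finally show ?thesis using phase_diff[OF assms(2), of _ x] by simp
  qed
  have "complex_of_real (LINT x|\<sigma>. (cmod (parabolic_sum a d x N))\<^sup>2)
      = (LINT x|\<sigma>. complex_of_real ((cmod (parabolic_sum a d x N))\<^sup>2))"
    by (rule integral_complex_of_real[symmetric])
  also have "\<dots> = (\<Sum>n\<in>?F. \<Sum>m\<in>?F. LINT x|\<sigma>. a n * cnj (a m) *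
      e (- (\<Sum>i=1..d. of_int (phase_difference d n m i) * x i)))"
    unfolding S using integrable_e_phase[OF assms(1)]
    by (simp add: Bochner_Integration.integral_sum)
  finally show ?thesis unfolding fourier_coeff_def by simp
qed

text \<open>The majorant of the entry (n, m) supplied by the decay hypothesis, without its constant.
  It is nonnegative and symmetric, as the Schur test requires.\<close>

definition decay_kernel :: "nat \<Rightarrow> (nat \<Rightarrow> nat) \<Rightarrow> (nat \<Rightarrow> nat) \<Rightarrow> real" where
  "decay_kernel d n m =
     (1 + L2_set (\<lambda>i. of_int (phase_difference d n m i)) {1..d}) powr (- ((real d - 1) / 2))"

text \<open>The Euclidean norm of a frequency dominates each of its components; the last component
  is the difference of the squared norms.\<close>

lemma decay_kernel_le:
  assumes "d \<ge> 1"
  shows "i \<in> {1..d - 1} \<Longrightarrow>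
      decay_kernel d n m \<le> (1 + \<bar>real (n i) - real (m i)\<bar>) powr (- ((real d - 1) / 2))"
    and "decay_kernel d n m \<le>
      (1 + \<bar>(\<Sum>i=1..d-1. (real (m i))\<^sup>2) - (\<Sum>i=1..d-1. (real (n i))\<^sup>2)\<bar>) powr (- ((real d - 1) / 2))"
proof -
  have *: "decay_kernel d n m \<le> (1 + \<bar>real_of_int (phase_difference d n m i)\<bar>) powr (- ((real d - 1) / 2))"
    if "i \<in> {1..d}" for i
    unfolding decay_kernel_def using assms that
    by (intro powr_mono2' add_left_mono abs_le_L2_set[where f = "\<lambda>i. real_of_int (phase_difference d n m i)"]) auto
  show "decay_kernel d n m \<le> (1 + \<bar>real (n i) - real (m i)\<bar>) powr (- ((real d - 1) / 2))"
    if i: "i \<in> {1..d - 1}"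
  proof -
    have "i \<in> {1..d}" using i by auto
    from *[OF this] show ?thesis
      unfolding phase_difference_simps(1)[OF i] by (simp only: abs_minus_commute)
  qed
  show "decay_kernel d n m \<le>
      (1 + \<bar>(\<Sum>i=1..d-1. (real (m i))\<^sup>2) - (\<Sum>i=1..d-1. (real (n i))\<^sup>2)\<bar>) powr (- ((real d - 1) / 2))"
    using *[of d] assms unfolding phase_difference_simps(2)[OF assms] by simp
qed

lemma decay_kernel_schur:
  assumes d: "d \<ge> 2"
  shows "\<exists>A. \<forall>N\<ge>2. \<forall>u. (\<Sum>n\<in>frequencies d N. \<Sum>m\<in>frequencies d N. decay_kernel d n m * (u n * u m))
      \<le> A * B d N * (\<Sum>n\<in>frequencies d N. (u n)\<^sup>2)"
proof -
  have "\<exists>A w. \<forall>N\<ge>2. \<forall>n\<in>frequencies d N. 0 < w n \<and>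
      (\<Sum>m\<in>frequencies d N. decay_kernel d n m * w m) \<le> A * B d N * w n"
  proof (cases "d = 2")
    case True
    define w where "w n = real (n 1) powr (-1/2)" for n :: "nat \<Rightarrow> nat"
    have "\<forall>N\<ge>2. \<forall>n\<in>frequencies d N.
        0 < w n \<and> (\<Sum>m\<in>frequencies d N. decay_kernel d n m * w m) \<le> 28 * B d N * w n"
    proof (intro allI impI ballI)
      fix N n assume N: "2 \<le> N" and n: "n \<in> frequencies d N"
      have I: "{1..d - 1} = {1}" using True by simp
      have n1: "n 1 \<in> {1..N}" using n unfolding frequencies_def I by (rule PiE_mem) simp
      \<comment> \<open>For d = 2 a frequency is an extensional function on {1}; this is the one
        with value t.\<close>
      let ?m = "\<lambda>t::nat. (\<lambda>_::nat. undefined :: nat)(1 := t)"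
      have F: "frequencies d N = PiE (insert 1 {}) (\<lambda>_. {1..N})"
        unfolding frequencies_def I ..
      have "(\<Sum>m\<in>frequencies d N. decay_kernel d n m * w m)
          = (\<Sum>t=1..N. decay_kernel d n (?m t) * w (?m t))"
        unfolding F by (subst sum_PiE_insert) (auto simp: fun_upd_def)
      also have "\<dots> = (\<Sum>t=1..N. decay_kernel d n (?m t) * real t powr (-1/2))"
        by (simp add: w_def)
      also have "\<dots> \<le> 28 * real (n 1) powr (-1/2)"
      proof (rule row_sum_le_one_dim)
        fix t
        show "decay_kernel d n (?m t) \<le> (1 + \<bar>(real t)\<^sup>2 - (real (n 1))\<^sup>2\<bar>) powr (-1/2)"
          using decay_kernel_le(2)[of d n "?m t"] by (simp add: True)
      qed (use n1 in \<open>auto simp: decay_kernel_def\<close>)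
      \<comment> \<open>For d = 2 the two powers of N in \<open>B\<close> cancel, so
        \<open>B d N\<close> is 1.\<close>
      also have "\<dots> = 28 * B d N * w n"
        using N by (simp add: B_def True w_def flip: powr_add)
      finally show "0 < w n \<and> (\<Sum>m\<in>frequencies d N. decay_kernel d n m * w m) \<le> 28 * B d N * w n"
        using n1 unfolding w_def by simp
    qed
    then show ?thesis by - (rule exI[where x = 28], rule exI[where x = w], assumption)
  next
    case False
    define k where "k = d - 1"
    have k: "k \<ge> 2" "d = Suc k" using d False by (auto simp: k_def)
    obtain A where A: "\<forall>N\<ge>2. \<forall>n\<in>{1..k} \<rightarrow>\<^sub>E {1..N}. \<forall>K :: (nat \<Rightarrow> nat) \<Rightarrow> real.
      (\<forall>m. 0 \<le> K m) \<and>
      (\<forall>m. \<forall>i\<in>{1..k}. K m \<le> (1 + \<bar>real (n i) - real (m i)\<bar>) powr (- (real k / 2))) \<and>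
      (\<forall>m. K m \<le> (1 + \<bar>(\<Sum>i=1..k. (real (m i))\<^sup>2) - (\<Sum>i=1..k. (real (n i))\<^sup>2)\<bar>) powr (- (real k / 2)))
      \<longrightarrow> (\<Sum>m\<in>{1..k} \<rightarrow>\<^sub>E {1..N}. K m) \<le> A * B (Suc k) N"
      using row_sum_le_B[OF k(1)] by (rule exE)
    have "(\<Sum>m\<in>frequencies d N. decay_kernel d n m) \<le> A * B d N"
      if "N \<ge> 2" "n \<in> frequencies d N" for N n
    proof -
      have "n \<in> {1..k} \<rightarrow>\<^sub>E {1..N}" using that unfolding frequencies_def k_def by simp
      note A = A[rule_format, OF that(1) this, of "decay_kernel d n"]
      have "(\<Sum>m\<in>{1..k} \<rightarrow>\<^sub>E {1..N}. decay_kernel d n m) \<le> A * B (Suc k) N"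
        using decay_kernel_le(1)[of d _ n] decay_kernel_le(2)[of d n] k(2)
        by (intro A conjI allI ballI) (auto simp: decay_kernel_def)
      then show ?thesis unfolding frequencies_def k(2) by simp
    qed
    then have "\<forall>N\<ge>2. \<forall>n\<in>frequencies d N. 0 < (1 :: real) \<and>
        (\<Sum>m\<in>frequencies d N. decay_kernel d n m * 1) \<le> A * B d N * 1"
      by simp
    then show ?thesis by - (rule exI[where x = A], rule exI[where x = "\<lambda>_. 1"], assumption)
  qed
  then obtain A w where w: "\<forall>N\<ge>2. \<forall>n\<in>frequencies d N. 0 < w n \<and>
      (\<Sum>m\<in>frequencies d N. decay_kernel d n m * w m) \<le> A * B d N * w n" by (elim exE)
  have "(\<Sum>n\<in>frequencies d N. \<Sum>m\<in>frequencies d N. decay_kernel d n m * (u n * u m))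
      \<le> A * B d N * (\<Sum>n\<in>frequencies d N. (u n)\<^sup>2)" if "N \<ge> 2" for N u
  proof (rule weighted_schur_test[OF finite_frequencies, where w = w])
    show "decay_kernel d n m = decay_kernel d m n" for n m
      unfolding decay_kernel_def L2_phase_difference_sym[of d n m] ..
  qed (use w that in \<open>auto simp: decay_kernel_def\<close>)
  then show ?thesis by (intro exI[of _ A]) simp
qed

lemma L2_estimate_of_fourier_decay:
  assumes d: "d \<ge> 2" and "torus_measure d \<sigma>" "fourier_decay d \<sigma>"
  shows "L2_estimate d \<sigma> (B d)"
proof -
  obtain C where C: "\<And>\<xi>. \<xi> \<in> {1..d} \<rightarrow>\<^sub>E UNIV \<Longrightarrow> cmod (fourier_coeff d \<sigma> \<xi>)
      \<le> C * (1 + L2_set (\<lambda>i. of_int (\<xi> i)) {1..d}) powr (- ((real d - 1) / 2))"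
    using assms(3) unfolding fourier_decay_def by blast
  obtain A where A: "\<And>N u. N \<ge> 2 \<Longrightarrow>
      (\<Sum>n\<in>frequencies d N. \<Sum>m\<in>frequencies d N. decay_kernel d n m * (u n * u m))
      \<le> A * B d N * (\<Sum>n\<in>frequencies d N. (u n)\<^sup>2)"
    using decay_kernel_schur[OF d] by blast
  \<comment> \<open>The frequency 0 forces this sign, which is needed to multiply the Schur bound by
    \<open>C\<close>.\<close>
  have C0: "0 \<le> C"
  proof -
    have "0 \<le> cmod (fourier_coeff d \<sigma> (\<lambda>i\<in>{1..d}. 0))" by simp
    also have "\<dots> \<le> C * (1 + L2_set (\<lambda>i. of_int ((\<lambda>i\<in>{1..d}. 0 :: int) i)) {1..d}) powr (- ((real d - 1) / 2))"
      by (rule C) simp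
    also have "L2_set (\<lambda>i. of_int ((\<lambda>i\<in>{1..d}. 0 :: int) i)) {1..d} = (0 :: real)"
      by (rule L2_set_0') simp
    finally show ?thesis by simp
  qed
  have "(LINT x|\<sigma>. (cmod (parabolic_sum a d x N))\<^sup>2)
      \<le> C * A * (L2_set (\<lambda>n. cmod (a n)) (frequencies d N))\<^sup>2 * B d N" if N: "N \<ge> 2" for N a
  proof -
    let ?F = "frequencies d N"
    have "(LINT x|\<sigma>. (cmod (parabolic_sum a d x N))\<^sup>2)
        \<le> cmod (complex_of_real (LINT x|\<sigma>. (cmod (parabolic_sum a d x N))\<^sup>2))"
      by simp
    also have "\<dots> \<le> (\<Sum>n\<in>?F. \<Sum>m\<in>?F. C * (decay_kernel d n m * (cmod (a n) * cmod (a m))))"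
    proof (subst integral_parabolic_sum[OF assms(2)], use d in simp, intro sum_norm_le)
      fix n m
      have "cmod (fourier_coeff d \<sigma> (phase_difference d n m)) \<le> C * decay_kernel d n m"
        unfolding decay_kernel_def by (rule C[OF phase_difference_funcset])
      then have "cmod (a n) * cmod (a m) * cmod (fourier_coeff d \<sigma> (phase_difference d n m))
          \<le> cmod (a n) * cmod (a m) * (C * decay_kernel d n m)"
        by (rule mult_left_mono) simp
      then show "cmod (a n * cnj (a m) * fourier_coeff d \<sigma> (phase_difference d n m))
          \<le> C * (decay_kernel d n m * (cmod (a n) * cmod (a m)))"
        by (simp add: norm_mult mult_ac)
    qed
    also have "\<dots> = C * (\<Sum>n\<in>?F. \<Sum>m\<in>?F. decay_kernel d n m * (cmod (a n) * cmod (a m)))"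
      by (simp add: sum_distrib_left)
    also have "\<dots> \<le> C * (A * B d N * (\<Sum>n\<in>?F. (cmod (a n))\<^sup>2))"
      using C0 by (intro mult_left_mono A[OF N])
    also have "(\<Sum>n\<in>?F. (cmod (a n))\<^sup>2) = (L2_set (\<lambda>n. cmod (a n)) ?F)\<^sup>2"
      unfolding L2_set_def by (simp add: sum_nonneg)
    finally show ?thesis by (simp add: mult_ac)
  qed
  then show ?thesis unfolding L2_estimate_def by blast
qed

subsection \<open>Fejer kernels\<close>

definition unit_interval :: "real measure" where
  "unit_interval = restrict_space lborel {0..<1}"

lemma finite_measure_unit_interval: "finite_measure unit_interval"
  by (rule finite_measureI) (simp add: unit_interval_def space_restrict_space emeasure_restrict_space)

interpretation unit_cube: product_sigma_finite "\<lambda>_ :: nat. unit_interval"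
  using finite_measure_unit_interval
  by (simp add: product_sigma_finite_def finite_measure.axioms(1))

lemma measurable_unit_interval:
  "f \<in> borel_measurable borel \<Longrightarrow> f \<in> borel_measurable unit_interval"
  unfolding unit_interval_def by (intro measurable_restrict_space1) simp

lemma integral_unit_interval_e:
  "(LINT t|unit_interval. e (of_int u * t)) = (if u = 0 then 1 else 0)"
proof (cases "u = 0")
  case True
  then show ?thesis
    by (simp add: unit_interval_def measure_restrict_space space_restrict_space)
next
  case False
  define z where "z = 2 * of_real pi * \<i> * of_int u"
  have z: "z \<noteq> 0" using False by (simp add: z_def)
  have e: "e (of_int u * t) = exp (of_real t * z)" for t
    by (simp add: e_def z_def mult_ac)
  have [measurable]: "(\<lambda>t. exp (complex_of_real t * z)) \<in> borel_measurable borel"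
    by (intro borel_measurable_continuous_onI continuous_intros)
  have "(LINT t|unit_interval. e (of_int u * t)) = (LINT t|lborel. indicator {0..<1} t *\<^sub>R exp (of_real t * z))"
    unfolding unit_interval_def e by (rule integral_restrict_space) simp
  \<comment> \<open>Adding the null set {1} gives the closed interval required by the fundamental
    theorem of calculus.\<close>
  also have "\<dots> = (LINT t|lborel. indicator {0..1} t *\<^sub>R exp (of_real t * z))"
  proof (rule integral_cong_AE)
    show "AE t in lborel. indicator {0..<1} t *\<^sub>R exp (of_real t * z) = indicator {0..1} t *\<^sub>R exp (of_real t * z)"
      using AE_lborel_singleton[of 1] by eventually_elim (auto simp: indicator_def)
  qed simp_all
  also have "\<dots> = exp (of_real 1 * z) / z - exp (of_real 0 * z) / z"
  proof (rule integral_FTC_Icc)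
    fix t :: real
    show "((\<lambda>t. exp (of_real t * z) / z) has_vector_derivative exp (of_real t * z)) (at t within {0..1})"
      by (rule has_vector_derivative_real_field[where f = "\<lambda>w. exp (w * z) / z"])
        (use z in \<open>auto intro!: derivative_eq_intros\<close>)
  qed (auto intro!: continuous_intros)
  also have "exp (of_real 1 * z) = 1"
    unfolding z_def by (simp add: exp_eq_1)
  finally show ?thesis using False by simp
qed

text \<open>Normalised to have integral 1 over the circle for M > 0. Being a squared modulus, it can
  serve as a density, and its Fourier coefficients are nonnegative too.\<close>

definition fejer :: "nat \<Rightarrow> real \<Rightarrow> real" where
  "fejer M t = (cmod (\<Sum>p<M. e (real p * t)))\<^sup>2 / real M"

text \<open>For M > 0 this is the triangle function max(0, 1 - |u| / M), written as the number of
  pairs (p, q) below M with p - q = u, divided by M; the bounds below are read off from this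
  count.\<close>

definition fejer_hat :: "nat \<Rightarrow> int \<Rightarrow> real" where
  "fejer_hat M u = real (card {p. p < M \<and> 0 \<le> int p - u \<and> int p - u < int M}) / real M"

lemma fejer_nonneg: "0 \<le> fejer M t"
  by (simp add: fejer_def)

lemma fejer_eq_sum:
  "complex_of_real (fejer M t) * e (- (of_int u * t))
     = (\<Sum>p<M. \<Sum>q<M. e (of_int (int p - int q - u) * t)) / of_nat M"
proof -
  have "complex_of_real ((cmod (\<Sum>p<M. e (real p * t)))\<^sup>2) = (\<Sum>p<M. \<Sum>q<M. e (real p * t) * e (- (real q * t)))"
    by (simp only: complex_norm_square cnj_sum cnj_e sum_product)
  then have "complex_of_real (fejer M t) * e (- (of_int u * t))
      = (\<Sum>p<M. \<Sum>q<M. e (real p * t) * e (- (real q * t)) * e (- (of_int u * t))) / of_nat M"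
    by (simp add: fejer_def sum_distrib_right)
  also have "(\<Sum>p<M. \<Sum>q<M. e (real p * t) * e (- (real q * t)) * e (- (of_int u * t)))
      = (\<Sum>p<M. \<Sum>q<M. e (of_int (int p - int q - u) * t))"
    by (intro sum.cong refl) (simp add: algebra_simps flip: e_add)
  finally show ?thesis .
qed

lemma integrable_unit_interval_e: "integrable unit_interval (\<lambda>t. e (of_int u * t))"
proof -
  interpret finite_measure unit_interval by (rule finite_measure_unit_interval)
  have "(\<lambda>t. e (of_int u * t)) \<in> borel_measurable unit_interval"
    by (rule measurable_unit_interval) measurable
  then show ?thesis by (intro integrable_const_bound[where B = 1]) auto
qed

lemma integrable_fejer: "integrable unit_interval (\<lambda>t. complex_of_real (fejer M t) * e (- (of_int u * t)))"
  unfolding fejer_eq_sum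
  by (intro integrable_divide Bochner_Integration.integrable_sum integrable_unit_interval_e)

lemma integral_fejer:
  "(LINT t|unit_interval. complex_of_real (fejer M t) * e (- (of_int u * t))) = of_real (fejer_hat M u)"
proof -
  have "(LINT t|unit_interval. complex_of_real (fejer M t) * e (- (of_int u * t)))
      = (\<Sum>p<M. \<Sum>q<M. LINT t|unit_interval. e (of_int (int p - int q - u) * t)) / of_nat M"
    unfolding fejer_eq_sum using integrable_unit_interval_e
    by (simp add: Bochner_Integration.integral_sum Bochner_Integration.integrable_sum del: of_int_diff)
  also have "(\<Sum>p<M. \<Sum>q<M. LINT t|unit_interval. e (of_int (int p - int q - u) * t))
      = (\<Sum>p<M. if 0 \<le> int p - u \<and> int p - u < int M then 1 else 0)"
  proof (intro sum.cong refl)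
    fix p
    have "(\<Sum>q<M. LINT t|unit_interval. e (of_int (int p - int q - u) * t))
        = (\<Sum>q<M. if int p - u = int q then 1 else 0)"
      unfolding integral_unit_interval_e by (intro sum.cong refl if_cong) auto
    also have "\<dots> = (if 0 \<le> int p - u \<and> int p - u < int M then 1 else 0)"
    proof (cases "0 \<le> int p - u")
      case True
      then have "(int p - u = int q) \<longleftrightarrow> (nat (int p - u) = q)" for q by auto
      moreover have "nat (int p - u) < M \<longleftrightarrow> int p - u < int M" using True by auto
      ultimately show ?thesis using True by (simp add: sum.delta')
    next
      case False
      then have "int p - u \<noteq> int q" for q by auto
      then show ?thesis using False by simp
    qed
    finally show "(\<Sum>q<M. LINT t|unit_interval. e (of_int (int p - int q - u) * t))
        = (if 0 \<le> int p - u \<and> int p - u < int M then 1 else 0 :: complex)" .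
  qed
  also have "\<dots> = of_nat (card {p. p < M \<and> 0 \<le> int p - u \<and> int p - u < int M})"
    by (simp add: sum.If_cases Int_def)
  finally show ?thesis by (simp add: fejer_hat_def)
qed

lemma fejer_hat_nonneg: "0 \<le> fejer_hat M u"
  by (simp add: fejer_hat_def)

lemma fejer_hat_le_1: "fejer_hat M u \<le> 1"
proof -
  have "card {p. p < M \<and> 0 \<le> int p - u \<and> int p - u < int M} \<le> card {..<M}"
    by (intro card_mono) auto
  then show ?thesis unfolding fejer_hat_def by (cases "M = 0") (auto simp: field_simps)
qed

lemma fejer_hat_eq_0: "int M \<le> \<bar>u\<bar> \<Longrightarrow> fejer_hat M u = 0"
proof -
  assume "int M \<le> \<bar>u\<bar>"
  then have "{p. p < M \<and> 0 \<le> int p - u \<and> int p - u < int M} = {}" by auto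
  then show ?thesis unfolding fejer_hat_def by simp
qed

text \<open>Among the 2H values of p, a block of H is admissible: the one starting at u if u \<ge>
  0, and the one starting at 0 if u < 0.\<close>

lemma fejer_hat_ge_half:
  assumes "0 < H" "\<bar>u\<bar> \<le> int H"
  shows "1 / 2 \<le> fejer_hat (2 * H) u"
proof -
  let ?A = "{p. p < 2 * H \<and> 0 \<le> int p - u \<and> int p - u < int (2 * H)}"
  have "H \<le> card ?A"
  proof (cases "0 \<le> u")
    case True
    have "card {nat u..<nat u + H} \<le> card ?A" using True assms by (intro card_mono) auto
    then show ?thesis by simp
  next
    case False
    have "card {..<H} \<le> card ?A" using False assms by (intro card_mono) auto
    then show ?thesis by simp
  qed
  then show ?thesis using assms(1) unfolding fejer_hat_def by (simp add: field_simps)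
qed

definition unit_cube :: "nat \<Rightarrow> (nat \<Rightarrow> real) measure" where
  "unit_cube d = (\<Pi>\<^sub>M i\<in>{1..d}. unit_interval)"

lemma sets_unit_cube: "sets (unit_cube d) = sets (torus d)"
  unfolding unit_cube_def torus_def unit_interval_def
  by (intro sets_PiM_cong refl sets_restrict_space_cong) simp

definition cube_fejer :: "nat \<Rightarrow> nat \<Rightarrow> (nat \<Rightarrow> real) \<Rightarrow> real" where
  "cube_fejer d M x = (\<Prod>i=1..d. fejer M (x i))"

lemma cube_fejer_nonneg: "0 \<le> cube_fejer d M x"
  unfolding cube_fejer_def by (intro prod_nonneg) (auto simp: fejer_nonneg)

lemma cube_fejer_e:
  "complex_of_real (cube_fejer d M x) * e (- (\<Sum>i=1..d. of_int (\<xi> i) * x i))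
     = (\<Prod>i=1..d. complex_of_real (fejer M (x i)) * e (- (of_int (\<xi> i) * x i)))"
  unfolding cube_fejer_def by (simp add: prod.distrib flip: e_sum sum_negf)

lemma integrable_cube_fejer_e:
  "integrable (unit_cube d) (\<lambda>x. complex_of_real (cube_fejer d M x) * e (- (\<Sum>i=1..d. of_int (\<xi> i) * x i)))"
  unfolding cube_fejer_e unit_cube_def
  by (rule unit_cube.product_integrable_prod) (auto intro: integrable_fejer)

lemma integral_cube_fejer_e:
  "(LINT x|unit_cube d. complex_of_real (cube_fejer d M x) * e (- (\<Sum>i=1..d. of_int (\<xi> i) * x i)))
     = of_real (\<Prod>i=1..d. fejer_hat M (\<xi> i))"
  unfolding cube_fejer_e unit_cube_def
  by (subst unit_cube.product_integral_prod) (auto intro: integrable_fejer simp: integral_fejer)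

lemma integrable_cube_fejer: "integrable (unit_cube d) (cube_fejer d M)"
proof -
  have "integrable (unit_cube d) (\<lambda>x. complex_of_real (cube_fejer d M x))"
    using integrable_cube_fejer_e[of d M "\<lambda>_. 0"] by simp
  then show ?thesis by (simp only: complex_of_real_integrable_eq)
qed

lemma integral_cube_fejer_le: "(LINT x|unit_cube d. cube_fejer d M x) \<le> 1"
proof -
  have "complex_of_real (LINT x|unit_cube d. cube_fejer d M x) = of_real (\<Prod>i=1..d. fejer_hat M 0)"
    using integral_cube_fejer_e[of d M "\<lambda>_. 0"] by simp
  then have "(LINT x|unit_cube d. cube_fejer d M x) = (\<Prod>i=1..d. fejer_hat M 0)"
    by (simp only: of_real_eq_iff)
  also have "\<dots> \<le> 1" by (intro prod_le_1) (auto simp: fejer_hat_nonneg fejer_hat_le_1)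
  finally show ?thesis .
qed

text \<open>Tonelli's theorem makes the series converge almost everywhere, which is all that can be
  asked: the series used below diverges at the origin, where \<open>suminf\<close> carries no
  information. Hence the integrals of the density are handled through almost-everywhere
  statements.\<close>

lemma
  fixes f :: "nat \<Rightarrow> 'a \<Rightarrow> real"
  assumes int: "\<And>j. integrable M (f j)" and nonneg: "\<And>j x. 0 \<le> f j x"
    and sum: "summable (\<lambda>j. LINT x|M. f j x)"
  shows finite_measure_density_suminf: "finite_measure (density M (\<lambda>x. ennreal (\<Sum>j. f j x)))"
    and sums_integral_density_suminf:
      "g \<in> borel_measurable M \<Longrightarrow> (\<And>x. norm (g x :: complex) \<le> 1) \<Longrightarrow>
        (\<lambda>j. LINT x|M. f j x *\<^sub>R g x) sums (LINT x|density M (\<lambda>x. ennreal (\<Sum>j. f j x)). g x)"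
proof -
  have [measurable]: "f j \<in> borel_measurable M" for j using int by auto
  have "(\<integral>\<^sup>+x. (\<Sum>j. ennreal (f j x)) \<partial>M) = (\<Sum>j. \<integral>\<^sup>+x. ennreal (f j x) \<partial>M)"
    by (rule nn_integral_suminf) simp
  also have "\<dots> = (\<Sum>j. ennreal (LINT x|M. f j x))"
    using int nonneg by (simp add: nn_integral_eq_integral)
  also have "\<dots> \<noteq> \<infinity>"
    using sum nonneg by (simp add: ennreal_suminf_neq_top integral_nonneg)
  finally have fin: "(\<integral>\<^sup>+x. (\<Sum>j. ennreal (f j x)) \<partial>M) \<noteq> \<infinity>" .
  have "AE x in M. (\<Sum>j. ennreal (f j x)) \<noteq> \<infinity>"
    by (rule nn_integral_PInf_AE[OF _ fin]) measurable
  then have AE: "AE x in M. summable (\<lambda>j. f j x)"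
    by eventually_elim (auto intro: summable_suminf_not_top nonneg)
  have AE0: "AE x in M. 0 \<le> (\<Sum>j. f j x)"
    using AE by eventually_elim (intro suminf_nonneg, auto simp: nonneg)
  have int_sum: "integrable M (\<lambda>x. \<Sum>j. f j x)"
    using int AE sum nonneg by (intro integrable_suminf) auto
  show "finite_measure (density M (\<lambda>x. ennreal (\<Sum>j. f j x)))"
  proof (rule finite_measureI)
    have "emeasure (density M (\<lambda>x. ennreal (\<Sum>j. f j x))) (space M) = (\<integral>\<^sup>+x. ennreal (\<Sum>j. f j x) \<partial>M)"
      by (subst emeasure_density) (auto intro!: nn_integral_cong)
    also have "\<dots> = ennreal (LINT x|M. (\<Sum>j. f j x))"
      by (rule nn_integral_eq_integral[OF int_sum AE0])
    finally show "emeasure (density M (\<lambda>x. ennreal (\<Sum>j. f j x)))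
        (space (density M (\<lambda>x. ennreal (\<Sum>j. f j x)))) \<noteq> \<infinity>" by simp
  qed
  assume [measurable]: "g \<in> borel_measurable M" and g: "\<And>x. norm (g x) \<le> 1"
  \<comment> \<open>As |g| \<le> 1, each term is dominated by \<open>f j\<close>, whose integrals
    are summable; this justifies integrating term by term.\<close>
  have le: "norm (f j x *\<^sub>R g x) \<le> f j x" for j x
    using mult_left_mono[OF g, of "f j x" x] nonneg[of j x] by simp
  have int': "integrable M (\<lambda>x. f j x *\<^sub>R g x)" for j
  proof (rule Bochner_Integration.integrable_bound[OF int[of j]])
    show "AE x in M. norm (f j x *\<^sub>R g x) \<le> norm (f j x)"
      by (intro AE_I2) (use le[of j] nonneg[of j] in \<open>simp only: real_norm_def abs_of_nonneg\<close>)
  qed measurable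
  have "(LINT x|density M (\<lambda>x. ennreal (\<Sum>j. f j x)). g x) = (LINT x|M. (\<Sum>j. f j x) *\<^sub>R g x)"
    using AE0 by (intro integral_density) auto
  also have "\<dots> = (LINT x|M. (\<Sum>j. f j x *\<^sub>R g x))"
    using AE by (intro integral_cong_AE) (auto elim!: eventually_mono simp: suminf_scaleR_left)
  finally have *: "(LINT x|density M (\<lambda>x. ennreal (\<Sum>j. f j x)). g x) = (LINT x|M. (\<Sum>j. f j x *\<^sub>R g x))" .
  show "(\<lambda>j. LINT x|M. f j x *\<^sub>R g x) sums (LINT x|density M (\<lambda>x. ennreal (\<Sum>j. f j x)). g x)"
    unfolding *
  proof (rule sums_integral[OF int'])
    show "AE x in M. summable (\<lambda>j. norm (f j x *\<^sub>R g x))"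
      using AE
      by eventually_elim (rule summable_comparison_test'[where N = 0], assumption, simp only: real_norm_def abs_norm_cancel, rule le)
    have "norm (LINT x|M. norm (f j x *\<^sub>R g x)) \<le> (LINT x|M. f j x)" for j
    proof -
      have "(LINT x|M. norm (f j x *\<^sub>R g x)) \<le> (LINT x|M. f j x)"
        by (intro integral_mono integrable_norm int' int le)
      then show ?thesis by (simp add: integral_nonneg)
    qed
    then show "summable (\<lambda>j. LINT x|M. norm (f j x *\<^sub>R g x))"
      by (intro summable_comparison_test'[OF sum]) auto
  qed
qed

subsection \<open>The extremal measure\<close>

text \<open>The size that the decay condition permits at frequencies of order 2^j.\<close>

definition extremal_weight :: "nat \<Rightarrow> nat \<Rightarrow> real" where
  "extremal_weight d j = (2 ^ j) powr (- ((real d - 1) / 2))"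

text \<open>The contribution of scale 2^j to the Fourier coefficient at \<xi>. The kernels have
  length 2 * 2^j so that their coefficients are at least 1/2 up to frequency 2^j.\<close>

definition extremal_hat :: "nat \<Rightarrow> (nat \<Rightarrow> int) \<Rightarrow> nat \<Rightarrow> real" where
  "extremal_hat d \<xi> j = extremal_weight d j * (\<Prod>i=1..d. fejer_hat (2 * 2 ^ j) (\<xi> i))"

text \<open>A superposition of Fejer kernels over all dyadic scales, comparable to
  \<open>\<bar>x\<bar> powr (- (d + 1) / 2)\<close> near the origin.\<close>
definition extremal_measure :: "nat \<Rightarrow> (nat \<Rightarrow> real) measure" where
  "extremal_measure d = density (unit_cube d)
     (\<lambda>x. ennreal (\<Sum>j. extremal_weight d j * cube_fejer d (2 * 2 ^ j) x))"

lemma extremal_weight_eq: "extremal_weight d j = (2 powr (- ((real d - 1) / 2))) ^ j"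
proof -
  have "(2 :: real) ^ j = 2 powr real j" by (simp add: powr_realpow)
  then show ?thesis unfolding extremal_weight_def
    by (simp only: powr_powr) (simp add: powr_power mult.commute)
qed

lemma extremal_weight_nonneg: "0 \<le> extremal_weight d j"
  by (simp add: extremal_weight_def)

lemma summable_extremal_weight: "d \<ge> 2 \<Longrightarrow> summable (extremal_weight d)"
  unfolding extremal_weight_eq[abs_def] by (intro summable_geometric) (simp add: powr_less_one)

lemma extremal_hat_nonneg: "0 \<le> extremal_hat d \<xi> j"
  unfolding extremal_hat_def
  by (intro mult_nonneg_nonneg prod_nonneg) (auto simp: extremal_weight_nonneg fejer_hat_nonneg)

lemma extremal_hat_le: "extremal_hat d \<xi> j \<le> extremal_weight d j"
proof -
  have "(\<Prod>i=1..d. fejer_hat (2 * 2 ^ j) (\<xi> i)) \<le> 1"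
    by (intro prod_le_1) (auto simp: fejer_hat_nonneg fejer_hat_le_1)
  from mult_left_mono[OF this extremal_weight_nonneg[of d j]] show ?thesis
    by (simp add: extremal_hat_def)
qed

lemma summable_extremal_hat: "d \<ge> 2 \<Longrightarrow> summable (extremal_hat d \<xi>)"
  by (rule summable_comparison_test'[OF summable_extremal_weight])
    (auto simp: extremal_hat_nonneg extremal_hat_le)

lemma
  assumes d: "d \<ge> 2"
  shows extremal_torus_measure: "torus_measure d (extremal_measure d)"
    and fourier_coeff_extremal: "fourier_coeff d (extremal_measure d) \<xi> = of_real (\<Sum>j. extremal_hat d \<xi> j)"
proof -
  let ?f = "\<lambda>j x. extremal_weight d j * cube_fejer d (2 * 2 ^ j) x"
  have int: "integrable (unit_cube d) (?f j)" for j
    by (intro integrable_mult_right integrable_cube_fejer)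
  have nonneg: "0 \<le> ?f j x" for j x
    by (intro mult_nonneg_nonneg extremal_weight_nonneg cube_fejer_nonneg)
  have "(LINT x|unit_cube d. ?f j x) \<le> extremal_weight d j" for j
    using mult_left_mono[OF integral_cube_fejer_le[of d "2 * 2 ^ j"] extremal_weight_nonneg[of d j]]
    by simp
  then have sum: "summable (\<lambda>j. LINT x|unit_cube d. ?f j x)"
    by (intro summable_comparison_test'[OF summable_extremal_weight[OF d]])
      (auto simp: nonneg integral_nonneg simp del: integral_mult_right_zero)
  show torus: "torus_measure d (extremal_measure d)"
    unfolding torus_measure_def extremal_measure_def
    using finite_measure_density_suminf[of "unit_cube d" ?f, OF int nonneg sum] sets_unit_cube[of d] by simp
  have e_meas: "(\<lambda>x. e (- (\<Sum>i=1..d. of_int (\<xi> i) * x i))) \<in> borel_measurable (unit_cube d)"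
    using borel_measurable_integrable[OF integrable_e_phase[OF torus, of \<xi>]]
    unfolding extremal_measure_def by simp
  have "(\<lambda>j. LINT x|unit_cube d. ?f j x *\<^sub>R e (- (\<Sum>i=1..d. of_int (\<xi> i) * x i)))
      sums fourier_coeff d (extremal_measure d) \<xi>"
    unfolding fourier_coeff_def extremal_measure_def
    by (rule sums_integral_density_suminf[of "unit_cube d" ?f, OF int nonneg sum e_meas]) simp
  moreover have "(LINT x|unit_cube d. ?f j x *\<^sub>R e (- (\<Sum>i=1..d. of_int (\<xi> i) * x i)))
      = of_real (extremal_hat d \<xi> j)" for j
    unfolding extremal_hat_def of_real_mult integral_cube_fejer_e[symmetric]
    by (simp add: scaleR_conv_of_real mult.assoc)
  moreover have "(\<lambda>j. complex_of_real (extremal_hat d \<xi> j)) sums of_real (\<Sum>j. extremal_hat d \<xi> j)"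
    using summable_extremal_hat[OF d] by (simp add: sums_of_real summable_sums)
  ultimately show "fourier_coeff d (extremal_measure d) \<xi> = of_real (\<Sum>j. extremal_hat d \<xi> j)"
    using sums_unique2 by auto
qed

text \<open>Scales well below |\<xi>| do not see \<xi>, since Fejer coefficients vanish beyond the
  length of the kernel. The other scales form a geometric series dominated by its first term, which
  has the required size.\<close>

lemma extremal_fourier_decay:
  assumes d: "d \<ge> 2"
  shows "fourier_decay d (extremal_measure d)"
proof -
  define \<beta> where "\<beta> = (real d - 1) / 2"
  define r where "r = (2 :: real) powr (-\<beta>)"
  have \<beta>: "\<beta> > 0" using d by (simp add: \<beta>_def)
  have r: "0 < r" "r < 1" using \<beta> unfolding r_def by (auto simp: powr_less_one)
  have w: "extremal_weight d j = r ^ j" for j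
    unfolding extremal_weight_eq r_def \<beta>_def ..
  have "cmod (fourier_coeff d (extremal_measure d) \<xi>)
      \<le> (3 * real d) powr \<beta> / (1 - r) * (1 + L2_set (\<lambda>i. of_int (\<xi> i)) {1..d}) powr (-\<beta>)" for \<xi>
  proof -
    define Y where "Y = 1 + L2_set (\<lambda>i. real_of_int (\<xi> i)) {1..d}"
    have Y: "1 \<le> Y" by (simp add: Y_def)
    obtain j1 where "Y / (3 * real d) < 2 ^ j1"
      using real_arch_pow[of 2 "Y / (3 * real d)"] by auto
    then have ex: "Y / (3 * real d) \<le> 2 ^ j1" by simp
    \<comment> \<open>The first scale that may contribute. If no coordinate of \<xi> reached 2 *
      2^j, then Y \<le> 1 + 2 d 2^j \<le> 3 d 2^j; this is the origin of 3 d, and below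
      \<open>j0\<close> some factor must vanish.\<close>
    define j0 where "j0 = (LEAST j. Y / (3 * real d) \<le> 2 ^ j)"
    have j0: "Y / (3 * real d) \<le> 2 ^ j0"
      unfolding j0_def using ex by (rule LeastI)
    have zero: "extremal_hat d \<xi> j = 0" if "j < j0" for j
    proof -
      have small: "2 ^ j < Y / (3 * real d)"
        using not_less_Least[OF that[unfolded j0_def]] by simp
      have "\<exists>i\<in>{1..d}. int (2 * 2 ^ j) \<le> \<bar>\<xi> i\<bar>"
      proof (rule ccontr)
        assume "\<not> ?thesis"
        then have "\<bar>\<xi> i\<bar> \<le> 2 * 2 ^ j" if "i \<in> {1..d}" for i using that by force
        then have "real_of_int \<bar>\<xi> i\<bar> \<le> real_of_int (2 * 2 ^ j)" if "i \<in> {1..d}" for i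
          using that by (simp only: of_int_le_iff)
        then have lt: "\<bar>real_of_int (\<xi> i)\<bar> \<le> 2 * 2 ^ j" if "i \<in> {1..d}" for i using that by simp
        have "Y \<le> 1 + (\<Sum>i=1..d. \<bar>real_of_int (\<xi> i)\<bar>)"
          unfolding Y_def by (intro add_left_mono L2_set_le_sum_abs)
        also have "\<dots> \<le> 1 + (\<Sum>i=1..d. 2 * 2 ^ j)" using lt by (intro add_left_mono sum_mono)
        also have "\<dots> = 1 + real d * (2 * 2 ^ j)" by simp
        also have "1 \<le> real d * 2 ^ j"
          using d mult_mono[of 1 "real d" 1 "2 ^ j"] by simp
        finally have "Y \<le> 3 * real d * 2 ^ j" by simp
        with small d show False by (simp add: field_simps)
      qed
      then have "\<exists>i\<in>{1..d}. fejer_hat (2 * 2 ^ j) (\<xi> i) = 0" using fejer_hat_eq_0 by blast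
      then have "(\<Prod>i=1..d. fejer_hat (2 * 2 ^ j) (\<xi> i)) = 0" by (simp add: prod_zero_iff)
      then show ?thesis by (simp add: extremal_hat_def)
    qed
    have "(\<Sum>j. extremal_hat d \<xi> j) = (\<Sum>j. extremal_hat d \<xi> (j + j0))"
      using suminf_split_initial_segment[OF summable_extremal_hat[OF d], of \<xi> j0] zero by simp
    also have "\<dots> \<le> (\<Sum>j. r ^ j0 * r ^ j)"
    proof (rule suminf_le)
      fix j
      show "extremal_hat d \<xi> (j + j0) \<le> r ^ j0 * r ^ j"
        using extremal_hat_le[of d \<xi> "j + j0"] unfolding w by (simp add: power_add mult.commute)
    next
      show "summable (\<lambda>j. extremal_hat d \<xi> (j + j0))"
        using summable_extremal_hat[OF d] by (rule summable_ignore_initial_segment)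
      show "summable (\<lambda>j. r ^ j0 * r ^ j)" using r by (intro summable_mult summable_geometric) auto
    qed
    also have "\<dots> = r ^ j0 / (1 - r)"
      using r by (subst suminf_mult) (auto simp: suminf_geometric intro: summable_geometric)
    also have "r ^ j0 = (2 ^ j0) powr (-\<beta>)"
      unfolding w[symmetric] extremal_weight_def \<beta>_def ..
    also have "(2 ^ j0) powr (-\<beta>) / (1 - r) \<le> (Y / (3 * real d)) powr (-\<beta>) / (1 - r)"
      using j0 Y d \<beta> r by (intro divide_right_mono powr_mono2') auto
    also have "(Y / (3 * real d)) powr (-\<beta>) = Y powr (-\<beta>) / (3 * real d) powr (-\<beta>)"
      using Y by (simp add: powr_divide)
    also have "(3 * real d) powr (-\<beta>) = 1 / (3 * real d) powr \<beta>"
      by (rule powr_minus_divide)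
    finally have "(\<Sum>j. extremal_hat d \<xi> j) \<le> (3 * real d) powr \<beta> / (1 - r) * Y powr (-\<beta>)"
      by (simp add: mult.commute)
    moreover have "0 \<le> (\<Sum>j. extremal_hat d \<xi> j)"
      by (intro suminf_nonneg summable_extremal_hat[OF d] extremal_hat_nonneg)
    ultimately show ?thesis by (simp add: fourier_coeff_extremal[OF d] Y_def)
  qed
  then show ?thesis unfolding fourier_decay_def \<beta>_def[symmetric] by blast
qed

section \<open>Counting pairs of frequencies: the lower bound\<close>

lemma pair_count_ge:
  fixes \<phi> :: "'a \<Rightarrow> nat"
  assumes "finite F" "0 < H" and D: "\<And>n. n \<in> F \<Longrightarrow> \<phi> n \<le> D"
  shows "(real (card F))\<^sup>2 \<le> (1 + real D / real H)
      * (\<Sum>n\<in>F. \<Sum>m\<in>F. if \<bar>int (\<phi> n) - int (\<phi> m)\<bar> \<le> int H then 1 else 0)"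
proof -
  \<comment> \<open>The class sizes when the values of \<phi> are cut into blocks of length H. There
    are at most 1 + D / H blocks.\<close>
  define c where "c q = real (card {n \<in> F. \<phi> n div H = q})" for q
  let ?Q = "{..D div H}"
  have maps: "(\<lambda>n. \<phi> n div H) ` F \<subseteq> ?Q" using D by (auto intro: div_le_mono)
  have "real (card F) = (\<Sum>q\<in>?Q. c q)"
    using sum.group[OF assms(1) _ maps, of "\<lambda>_. 1 :: real"] by (simp add: c_def)
  \<comment> \<open>Cauchy-Schwarz; the sum of the squares counts the ordered pairs lying in a
    common block, and these differ by less than H in \<phi>.\<close>
  then have "(real (card F))\<^sup>2 \<le> (\<Sum>q\<in>?Q. (c q)\<^sup>2) * real (card ?Q)"
    by (simp only: sum_squared_le_sum_of_squares)
  also have "(\<Sum>q\<in>?Q. (c q)\<^sup>2) = (\<Sum>q\<in>?Q. \<Sum>n\<in>{n \<in> F. \<phi> n div H = q}. c (\<phi> n div H))"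
    by (intro sum.cong refl) (simp add: c_def power2_eq_square)
  also have "\<dots> = (\<Sum>n\<in>F. c (\<phi> n div H))"
    by (rule sum.group[OF assms(1) _ maps]) simp
  also have "\<dots> = (\<Sum>n\<in>F. \<Sum>m\<in>F. if \<phi> m div H = \<phi> n div H then 1 else 0)"
    using assms(1) by (intro sum.cong refl) (simp add: c_def sum.If_cases Int_def)
  also have "\<dots> * real (card ?Q) \<le> (\<Sum>n\<in>F. \<Sum>m\<in>F. if \<bar>int (\<phi> n) - int (\<phi> m)\<bar> \<le> int H then 1 else 0) * (1 + real D / real H)"
  proof (intro mult_mono sum_mono)
    fix n m
    have "\<bar>int (\<phi> n) - int (\<phi> m)\<bar> \<le> int H" if "\<phi> m div H = \<phi> n div H"
    proof -
      have "\<phi> n = \<phi> n div H * H + \<phi> n mod H" "\<phi> m = \<phi> n div H * H + \<phi> m mod H"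
        using div_mult_mod_eq[of "\<phi> n" H] div_mult_mod_eq[of "\<phi> m" H] that by auto
      moreover have "\<phi> n mod H < H" "\<phi> m mod H < H" using \<open>0 < H\<close> by auto
      ultimately show ?thesis by linarith
    qed
    then show "(if \<phi> m div H = \<phi> n div H then 1 else 0)
        \<le> (if \<bar>int (\<phi> n) - int (\<phi> m)\<bar> \<le> int H then 1 else 0 :: real)" by auto
  next
    show "real (card ?Q) \<le> 1 + real D / real H"
      using of_nat_div_le_of_nat[of D H, where ?'a = real] by simp
  qed (auto intro!: sum_nonneg)
  finally show ?thesis by (simp only: mult.commute)
qed

lemma card_frequencies: "card (frequencies d N) = N ^ (d - 1)"
  by (simp add: frequencies_def card_PiE)

text \<open>Since N \<le> H, the differences of the first d - 1 coordinates never exceed H. Only the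
  difference of the squared norms is a genuine condition, and each of the d factors is then at least
  1/2.\<close>

lemma prod_fejer_hat_ge:
  assumes d: "d \<ge> 2" and n: "n \<in> frequencies d N" and m: "m \<in> frequencies d N" and "0 < H" "N \<le> H"
  shows "(1 / 2) ^ d * (if \<bar>int (\<Sum>i=1..d-1. (n i)\<^sup>2) - int (\<Sum>i=1..d-1. (m i)\<^sup>2)\<bar> \<le> int H then 1 else 0)
      \<le> (\<Prod>i=1..d. fejer_hat (2 * H) (phase_difference d n m i))"
proof (cases "\<bar>int (\<Sum>i=1..d-1. (n i)\<^sup>2) - int (\<Sum>i=1..d-1. (m i)\<^sup>2)\<bar> \<le> int H")
  case True
  have "(1 / 2) ^ d = (\<Prod>i=1..d. 1 / 2 :: real)" by simp
  also have "\<dots> \<le> (\<Prod>i=1..d. fejer_hat (2 * H) (phase_difference d n m i))"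
  proof (intro prod_mono conjI fejer_hat_ge_half \<open>0 < H\<close>)
    fix i assume i: "i \<in> {1..d}"
    show "\<bar>phase_difference d n m i\<bar> \<le> int H"
    proof (cases "i = d")
      case True
      then show ?thesis using \<open>\<bar>_\<bar> \<le> int H\<close> d by (simp add: phase_difference_def abs_minus_commute)
    next
      case False
      with i have id: "i \<in> {1..d-1}" "i < d" by auto
      then have "n i \<in> {1..N}" "m i \<in> {1..N}" using n m unfolding frequencies_def by blast+
      then show ?thesis using i id(2) \<open>N \<le> H\<close> by (auto simp: phase_difference_def)
    qed
  qed simp
  finally show ?thesis using True by simp
qed (auto intro: prod_nonneg fejer_hat_nonneg)

text \<open>With N = 2^p, scale H = 2^j contributes about N^(d-3) H^((3-d)/2) per unit of the
  squared norm of the coefficients. This accounts for the three cases of \<open>B\<close>: for d = 2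
  the top scale N^2 suffices, for d = 3 all p + 1 scales contribute equally and give the logarithm,
  and for d \<ge> 4 the bottom scale N suffices.\<close>

lemma dyadic_sum_ge_B:
  assumes d: "d \<ge> 2" and p: "p \<ge> 1"
  shows "B d (2 ^ p) \<le> real (2 ^ p) powr (real d - 3) * (\<Sum>j=p..2*p. (2 ^ j) powr ((3 - real d) / 2))"
proof -
  define N :: real where "N = 2 ^ p"
  have N: "N \<ge> 1" "real (2 ^ p) = N" by (auto simp: N_def)
  have ge: "(2 ^ j) powr ((3 - real d) / 2) \<le> (\<Sum>j=p..2*p. (2 ^ j) powr ((3 - real d) / 2))"
    if "j \<in> {p..2*p}" for j
    using that by (intro member_le_sum[where f = "\<lambda>j. (2 ^ j) powr ((3 - real d) / 2)"]) auto
  consider "d = 2" | "d = 3" | "d \<ge> 4" using d by linarith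
  then show ?thesis
  proof cases
    case 1
    have "B d (2 ^ p) = 1" unfolding B_def N(2) using 1 N(1) by (simp flip: powr_add)
    also have "1 = N powr (real d - 3) * (2 ^ (2 * p)) powr ((3 - real d) / 2)"
    proof -
      have "(2 :: real) ^ (2 * p) = N powr 2" using N(1) by (simp add: N_def power_mult_distrib power_even_eq)
      then have "(2 ^ (2 * p)) powr ((3 - real d) / 2) = N powr 1"
        using 1 by (simp only: powr_powr) simp
      then show ?thesis using 1 N(1) by (simp flip: powr_add)
    qed
    also have "\<dots> \<le> N powr (real d - 3) * (\<Sum>j=p..2*p. (2 ^ j) powr ((3 - real d) / 2))"
      by (intro mult_left_mono ge) auto
    finally show ?thesis unfolding N(2) .
  next
    case 2
    have "B d (2 ^ p) = ln N" unfolding B_def N(2) using 2 N(1) by simp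
    also have "\<dots> = real p * ln 2" unfolding N_def by (rule ln_realpow)
    also have "\<dots> \<le> real p * 1" using ln_le_minus_one[of 2] by (intro mult_left_mono) auto
    also have "\<dots> \<le> real (p + 1)" by simp
    also have "\<dots> = N powr (real d - 3) * (\<Sum>j=p..2*p. (2 ^ j) powr ((3 - real d) / 2))"
      using N(1) 2 by simp
    finally show ?thesis unfolding N(2) .
  next
    case 3
    have "B d (2 ^ p) = N powr ((real d - 3) / 2)" unfolding B_def N(2) using 3 by simp
    also have "\<dots> = N powr ((real d - 3) + (3 - real d) / 2)" by (rule arg_cong) (simp add: field_simps)
    also have "\<dots> = N powr (real d - 3) * (2 ^ p) powr ((3 - real d) / 2)"
      unfolding powr_add N_def ..
    also have "\<dots> \<le> N powr (real d - 3) * (\<Sum>j=p..2*p. (2 ^ j) powr ((3 - real d) / 2))"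
      by (intro mult_left_mono ge) auto
    finally show ?thesis unfolding N(2) .
  qed
qed

text \<open>In the constant, (1/2)^d comes from the d Fejer coefficients and 1/d from the number of
  blocks in the pigeonhole count. The cardinality is the squared norm of the constant coefficients
  1.\<close>

lemma integral_extremal_ge:
  assumes d: "d \<ge> 2" and p: "p \<ge> 1"
  defines "N \<equiv> 2 ^ p"
  shows "(1 / 2) ^ d / real d * real (card (frequencies d N)) * B d N
    \<le> (LINT x|extremal_measure d. (cmod (parabolic_sum (\<lambda>_. 1) d x N))\<^sup>2)"
proof -
  let ?F = "frequencies d N"
  define \<phi> where "\<phi> n = (\<Sum>i=1..d-1. (n i)\<^sup>2)" for n :: "nat \<Rightarrow> nat"
  define cnt where "cnt H = (\<Sum>n\<in>?F. \<Sum>m\<in>?F. if \<bar>int (\<phi> n) - int (\<phi> m)\<bar> \<le> int H then 1 else 0 :: real)" for H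
  have N: "real N \<ge> 1" unfolding N_def by simp
  have "complex_of_real (LINT x|extremal_measure d. (cmod (parabolic_sum (\<lambda>_. 1) d x N))\<^sup>2)
      = of_real (\<Sum>n\<in>?F. \<Sum>m\<in>?F. \<Sum>j. extremal_hat d (phase_difference d n m) j)"
    using d by (subst integral_parabolic_sum[OF extremal_torus_measure])
      (auto simp: fourier_coeff_extremal)
  then have eq: "(LINT x|extremal_measure d. (cmod (parabolic_sum (\<lambda>_. 1) d x N))\<^sup>2)
      = (\<Sum>n\<in>?F. \<Sum>m\<in>?F. \<Sum>j. extremal_hat d (phase_difference d n m) j)"
    by (simp only: of_real_eq_iff)
  \<comment> \<open>Squared norms are at most (d - 1) N^2. Since 2^j \<le> N^2, the extra 1 in the
    number of blocks is absorbed, leaving d N^2 / 2^j.\<close>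
  have cnt: "real N powr (2 * real d - 4) / real d * 2 ^ j \<le> cnt (2 ^ j)" if j: "j \<in> {p..2*p}" for j
  proof -
    have H: "(2 :: real) ^ j \<le> (real N)\<^sup>2"
    proof -
      have "(2 :: real) ^ j \<le> 2 ^ (2 * p)" using j by (intro power_increasing) auto
      then show ?thesis by (simp add: N_def power_even_eq)
    qed
    have "\<phi> n \<le> (d - 1) * N\<^sup>2" if "n \<in> ?F" for n
    proof -
      have "\<phi> n \<le> (\<Sum>i=1..d-1. N\<^sup>2)"
        unfolding \<phi>_def using that unfolding frequencies_def
        by (intro sum_mono power_mono) (auto simp: PiE_iff)
      then show ?thesis by simp
    qed
    then have "(real (card ?F))\<^sup>2 \<le> (1 + real ((d - 1) * N\<^sup>2) / real (2 ^ j)) * cnt (2 ^ j)"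
      unfolding cnt_def by (intro pair_count_ge finite_frequencies) auto
    also have "\<dots> \<le> (real d * (real N)\<^sup>2 / 2 ^ j) * cnt (2 ^ j)"
    proof (rule mult_right_mono)
      have "1 \<le> (real N)\<^sup>2 / 2 ^ j" using H by simp
      then show "1 + real ((d - 1) * N\<^sup>2) / real (2 ^ j) \<le> real d * (real N)\<^sup>2 / 2 ^ j"
        using d by (simp add: of_nat_diff field_simps)
    qed (auto simp: cnt_def intro!: sum_nonneg)
    finally have "(real N ^ (d - 1))\<^sup>2 * 2 ^ j \<le> real d * (real N)\<^sup>2 * cnt (2 ^ j)"
      by (simp add: card_frequencies field_simps)
    moreover have "(real N ^ (d - 1))\<^sup>2 = real N powr (2 * real d - 4) * (real N)\<^sup>2"
    proof -
      have "(real N ^ (d - 1))\<^sup>2 = real N ^ ((d - 1) * 2)" by (rule power_mult[symmetric])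
      also have "\<dots> = real N powr real ((d - 1) * 2)" using N by (intro powr_realpow[symmetric]) simp
      also have "real ((d - 1) * 2) = 2 * real d - 4 + 2" using d by (simp add: of_nat_diff)
      also have "real N powr (2 * real d - 4 + 2) = real N powr (2 * real d - 4) * real N powr 2"
        by (rule powr_add)
      finally show ?thesis using N by simp
    qed
    ultimately have "(real N)\<^sup>2 * (real N powr (2 * real d - 4) * 2 ^ j) \<le> (real N)\<^sup>2 * (real d * cnt (2 ^ j))"
      by (simp add: mult_ac)
    then have "real N powr (2 * real d - 4) * 2 ^ j \<le> real d * cnt (2 ^ j)"
      using N by simp
    then show ?thesis using d by (simp add: field_simps)
  qed
  have "(1 / 2) ^ d / real d * real (card ?F) * B d N
      \<le> (1 / 2) ^ d / real d * real (card ?F) * (real N powr (real d - 3) * (\<Sum>j=p..2*p. (2 ^ j) powr ((3 - real d) / 2)))"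
    using dyadic_sum_ge_B[OF d p] unfolding N_def by (intro mult_left_mono) auto
  also have "\<dots> = (\<Sum>j=p..2*p. extremal_weight d j * ((1 / 2) ^ d * (real N powr (2 * real d - 4) / real d * 2 ^ j)))"
  proof -
    have 1: "real (card ?F) * real N powr (real d - 3) = real N powr (2 * real d - 4)"
    proof -
      have "real (card ?F) = real N ^ (d - 1)" by (simp add: card_frequencies)
      also have "\<dots> = real N powr real (d - 1)" using N by (intro powr_realpow[symmetric]) simp
      also have "real (d - 1) = real d - 1" using d by (simp add: of_nat_diff)
      finally have "real (card ?F) = real N powr (real d - 1)" .
      moreover have "(real d - 1) + (real d - 3) = 2 * real d - 4" by simp
      ultimately show ?thesis by (simp only: powr_add[symmetric])
    qed
    have 2: "(2 ^ j) powr ((3 - real d) / 2) = extremal_weight d j * 2 ^ j" for j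
    proof -
      have "extremal_weight d j * 2 ^ j = (2 ^ j) powr (- ((real d - 1) / 2) + 1)"
        unfolding extremal_weight_def powr_add by simp
      also have "- ((real d - 1) / 2) + 1 = (3 - real d) / 2" by (simp add: field_simps)
      finally show ?thesis by simp
    qed
    have "(1 / 2) ^ d / real d * real (card ?F) * (real N powr (real d - 3) * (\<Sum>j=p..2*p. (2 ^ j) powr ((3 - real d) / 2)))
        = (1 / 2) ^ d / real d * (real (card ?F) * real N powr (real d - 3)) * (\<Sum>j=p..2*p. (2 ^ j) powr ((3 - real d) / 2))"
      by (simp only: mult_ac)
    then show ?thesis unfolding 1 2 by (simp add: sum_distrib_left sum_divide_distrib mult_ac)
  qed
  also have "\<dots> \<le> (\<Sum>j=p..2*p. extremal_weight d j * ((1 / 2) ^ d * cnt (2 ^ j)))"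
    using cnt by (intro sum_mono mult_left_mono extremal_weight_nonneg) auto
  also have "\<dots> \<le> (\<Sum>j=p..2*p. \<Sum>n\<in>?F. \<Sum>m\<in>?F. extremal_hat d (phase_difference d n m) j)"
  proof (rule sum_mono)
    fix j assume j: "j \<in> {p..2*p}"
    have "N \<le> 2 ^ j" unfolding N_def using j by (intro power_increasing) auto
    then have "(1 / 2) ^ d * cnt (2 ^ j)
        \<le> (\<Sum>n\<in>?F. \<Sum>m\<in>?F. \<Prod>i=1..d. fejer_hat (2 * 2 ^ j) (phase_difference d n m i))"
      unfolding cnt_def sum_distrib_left \<phi>_def by (intro sum_mono prod_fejer_hat_ge[OF d]) auto
    from mult_left_mono[OF this extremal_weight_nonneg[of d j]]
    show "extremal_weight d j * ((1 / 2) ^ d * cnt (2 ^ j))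
        \<le> (\<Sum>n\<in>?F. \<Sum>m\<in>?F. extremal_hat d (phase_difference d n m) j)"
      by (simp only: extremal_hat_def sum_distrib_left)
  qed
  also have "\<dots> = (\<Sum>n\<in>?F. \<Sum>m\<in>?F. \<Sum>j=p..2*p. extremal_hat d (phase_difference d n m) j)"
    by (subst sum.swap) (intro sum.cong refl, rule sum.swap)
  \<comment> \<open>All contributions are nonnegative, so restoring the scales outside p..2p can
    only increase the sum.\<close>
  also have "\<dots> \<le> (\<Sum>n\<in>?F. \<Sum>m\<in>?F. \<Sum>j. extremal_hat d (phase_difference d n m) j)"
    by (intro sum_mono sum_le_suminf summable_extremal_hat[OF d] extremal_hat_nonneg) auto
  finally show ?thesis unfolding eq .
qed

lemma B_pos: "N \<ge> 2 \<Longrightarrow> 0 < B d N"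
  by (simp add: B_def)

text \<open>For each d a single measure excludes every such \<open>b\<close>. With constant
  coefficients the cardinality cancels, and \<open>C * (b N / B d N)\<close> stays above a positive
  constant along N = 2^p.\<close>

lemma B_sharp:
  assumes d: "d \<ge> 2" and lim: "(\<lambda>N. b N / B d N) \<longlonglongrightarrow> 0"
  shows "\<not> L2_estimate d (extremal_measure d) b"
proof
  assume "L2_estimate d (extremal_measure d) b"
  then obtain C where C: "\<And>N a. N \<ge> 2 \<Longrightarrow>
      (LINT x|extremal_measure d. (cmod (parabolic_sum a d x N))\<^sup>2)
        \<le> C * (L2_set (\<lambda>n. cmod (a n)) (frequencies d N))\<^sup>2 * b N"
    unfolding L2_estimate_def by blast
  define c where "c = (1 / 2) ^ d / real d"
  have c: "0 < c" using d by (simp add: c_def)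
  have le: "c \<le> C * (b (2 ^ p) / B d (2 ^ p))" if p: "p \<ge> 1" for p
  proof -
    define N :: nat where "N = 2 ^ p"
    have N: "N \<ge> 2" unfolding N_def using power_increasing[OF p, of "2 :: nat"] by simp
    have card: "0 < real (card (frequencies d N))" using N by (simp add: card_frequencies)
    have L2: "(L2_set (\<lambda>n. cmod 1) (frequencies d N))\<^sup>2 = real (card (frequencies d N))"
      unfolding L2_set_def by simp
    have "c * real (card (frequencies d N)) * B d N \<le> C * real (card (frequencies d N)) * b N"
      using integral_extremal_ge[OF d p, folded N_def] C[OF N, of "\<lambda>_. 1"] unfolding L2 c_def by linarith
    then have "real (card (frequencies d N)) * (c * B d N) \<le> real (card (frequencies d N)) * (C * b N)"
      by (simp only: mult_ac)
    then have "c * B d N \<le> C * b N" using card by simp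
    then show ?thesis using B_pos[OF N] unfolding N_def by (simp add: field_simps)
  qed
  \<comment> \<open>The powers of 2 form a subsequence along which the assumed limit persists, which
    contradicts the lower bound \<open>c\<close>.\<close>
  have "(\<lambda>p. C * (b (2 ^ p) / B d (2 ^ p))) \<longlonglongrightarrow> C * 0"
    using LIMSEQ_subseq_LIMSEQ[OF lim, of "\<lambda>p. 2 ^ p"]
    by (intro tendsto_mult_left) (simp add: strict_mono_def o_def)
  then have "c \<le> C * 0" by (rule LIMSEQ_le_const) (use le in blast)
  then show False using c by simp
qed

theorem theorem11p1:
  fixes d :: nat
  assumes "d \<ge> 2"
  shows "(\<forall>\<sigma>. torus_measure d \<sigma> \<and> fourier_decay d \<sigma> \<longrightarrow> L2_estimate d \<sigma> (B d)) \<and>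
         (\<forall>b :: nat \<Rightarrow> real. (\<lambda>N. b N / B d N) \<longlonglongrightarrow> 0 \<longrightarrow>
            \<not> (\<forall>\<sigma>. torus_measure d \<sigma> \<and> fourier_decay d \<sigma> \<longrightarrow> L2_estimate d \<sigma> b))"
  using L2_estimate_of_fourier_decay[OF assms] B_sharp[OF assms]
    extremal_torus_measure[OF assms] extremal_fourier_decay[OF assms] by blast

end
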